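(* Let $a > 0$ and $\lambda > 0$, let $\xi \in \text{Min-U-Exp}(a; \lambda)$, and let $\tau$ be a random variable such that, for $x > 0$, the conditional distribution of $\tau$ given $\xi = x$ is exponential with rate $x$ (that is, with mean $1/x$). Then: (a) $\tau \in \text{Exp-Min-U-Exp}(a; \lambda)$. (b) $\tau \stackrel{d}{=} \frac{\eta}{\xi}$, where $\eta$ is exponentially distributed with mean $1$, and $\xi$ and $\eta$ are independent. (c) For $p \in (-1, 1)$, $$\mathbb{E}(\tau^p) = \frac{1}{a}\Gamma(p+1)\lambda^{p-1}\left((\lambda a+1)\gamma(1-p, a\lambda) -\gamma(2-p, a\lambda)\right),$$ and $\mathbb{E}(\tau^p) = \infty$ for all other real $p$. (d) The joint distribution of $\tau$ and $\xi$ is the bivariate Exp-Min-U-Exp distribution of the first kind with parameters $a$ and $\lambda$, and $(\tau, \xi) \stackrel{d}{=} \left(\frac{\eta}{\xi}, \xi\right)$, where $\eta$ is exponentially distributed with mean $1$, and $\xi$ and $\eta$ are independent. (e) For all $t > 0$, the conditional density of $\xi$ given $\tau = t$ is $P_{\xi}(x|\tau=t) = 0$ for $x \notin (0,a)$, and $$P_{\xi}(x|\tau=t) = \frac{x(\lambda + t)^3e^{-(\lambda + t)x}(1+\lambda a - \lambda x)}{a\lambda(\lambda + t) + (t-\lambda)(1-e^{-a(\lambda +t)})- a t (\lambda+t)e^{-a(\lambda + t)}}, \quad x \in (0, a).$$ (f) The mean square regression of $\tau$ on $\xi$ is $\mathbb{E}(\tau|\xi=x) = \frac{1}{x}$, $x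 > 0$. (g) The mean square regression of $\xi$ on $\tau$ is, for $t > 0$, $$\mathbb{E}(\xi|\tau=t) = \frac{2(t-2\lambda) +2a\lambda(t+\lambda)-e^{-a(\lambda +t)}\left(a^2t(\lambda+t)^2+2a(t^2-\lambda^2)+2(t-2\lambda)\right)}{a\lambda(\lambda+t)^2+(t^2-\lambda^2)(1-e^{-a(\lambda + t)})-at(\lambda+t)^2e^{-a(\lambda + t)}}.$$
   Context: Let $a>0$ and $\lambda>0$. A random variable $\xi$ is Min-U-Exp distributed, written $\xi \in \text{Min-U-Exp}(a;\lambda)$, if its cumulative distribution function is $$F_\xi(x) = \begin{cases} 0, & x \leq 0,\\ 1-e^{-\lambda x} + \frac{x}{a}e^{-\lambda x}, & x \in (0, a],\\ 1, & x > a.\end{cases}$$ Equivalently, $\xi$ has density $\frac{e^{-\lambda x}}{a}(\lambda a + 1 - \lambda x)$ on $(0,a)$ and $0$ elsewhere. A random variable $\tau$ is Exp-Min-U-Exp distributed, written $\tau \in \text{Exp-Min-U-Exp}(a;\lambda)$, if its cumulative distribution function is $$F_\tau(t) = \begin{cases} 0, & t \leq 0,\\ \frac{t}{\lambda+ t} - \frac{t}{a(\lambda + t)^2}\left(1-e^{-a(\lambda + t)}\right), & t > 0.\end{cases}$$ A random vector $(\tau,\xi)$ has the bivariate Exp-Min-U-Exp distribution of the first kind with parameters $a$ and $\lambda$ if it has joint density $$P_{\tau, \xi}(t,x) = \begin{cases} \frac{1}{a}\,x\,e^{-(\lambda + t)x}(1+\lambda a- \lambda x), & t > 0 \text{ and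 } x \in (0,a),\\ 0, & \text{otherwise.}\end{cases}$$ $\Gamma$ is the gamma function, $\gamma(s,x) = \int_0^x u^{s-1}e^{-u}\,du$ is the lower incomplete gamma function, and $\stackrel{d}{=}$ denotes equality in distribution. The conditional density $P_\xi(x|\tau=t)$ and the conditional expectations $\mathbb{E}(\tau|\xi=x)$, $\mathbb{E}(\xi|\tau=t)$ are those computed from the joint density of $(\tau,\xi)$ and the given conditional law of $\tau$ given $\xi=x$. *)

theory Defs
  imports "HOL-Probability.Probability"
begin

definition min_u_exp_cdf :: "real \<Rightarrow> real \<Rightarrow> real \<Rightarrow> real" where
  "min_u_exp_cdf a l x =
     (if x \<le> 0 then 0
      else if x \<le> a then 1 - exp (- l * x) + x / a * exp (- l * x)
      else 1)"

definition min_u_exp_distributed :: "'a measure \<Rightarrow> real \<Rightarrow> real \<Rightarrow> ('a \<Rightarrow> real) \<Rightarrow> bool" where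
  "min_u_exp_distributed M a l X \<longleftrightarrow>
     X \<in> borel_measurable M \<and> (\<forall>x. cdf (distr M borel X) x = min_u_exp_cdf a l x)"

definition exp_min_u_exp_cdf :: "real \<Rightarrow> real \<Rightarrow> real \<Rightarrow> real" where
  "exp_min_u_exp_cdf a l t =
     (if t \<le> 0 then 0
      else t / (l + t) - t / (a * (l + t)\<^sup>2) * (1 - exp (- a * (l + t))))"

definition exp_min_u_exp_distributed :: "'a measure \<Rightarrow> real \<Rightarrow> real \<Rightarrow> ('a \<Rightarrow> real) \<Rightarrow> bool" where
  "exp_min_u_exp_distributed M a l X \<longleftrightarrow>
     X \<in> borel_measurable M \<and> (\<forall>t. cdf (distr M borel X) t = exp_min_u_exp_cdf a l t)"

definition biv_exp_min_u_exp_density :: "real \<Rightarrow> real \<Rightarrow> real \<Rightarrow> real \<Rightarrow> real" where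
  "biv_exp_min_u_exp_density a l t x =
     (if 0 < t \<and> 0 < x \<and> x < a
      then 1 / a * x * exp (- (l + t) * x) * (1 + l * a - l * x)
      else 0)"

definition biv_exp_min_u_exp_distributed ::
    "'a measure \<Rightarrow> real \<Rightarrow> real \<Rightarrow> ('a \<Rightarrow> real \<times> real) \<Rightarrow> bool" where
  "biv_exp_min_u_exp_distributed M a l Z \<longleftrightarrow>
     distributed M (lborel \<Otimes>\<^sub>M lborel) Z
       (\<lambda>(t, x). ennreal (biv_exp_min_u_exp_density a l t x))"

definition lower_inc_gamma :: "real \<Rightarrow> real \<Rightarrow> real" where
  "lower_inc_gamma s x = (LBINT u:{0..x}. u powr (s - 1) * exp (- u))"

text \<open>
  For \<open>x\<close> in the Borel set \<open>S\<close>, the conditional distribution of \<open>Y\<close> given \<open>X = x\<close> is \<open>K x\<close>: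
  \<open>K\<close> is a probability kernel on \<open>S\<close> that disintegrates the joint law of \<open>(X, Y)\<close>
  over the part of the law of \<open>X\<close> carried by \<open>S\<close>.
\<close>

definition has_cond_distr_on ::
    "'a measure \<Rightarrow> ('a \<Rightarrow> real) \<Rightarrow> ('a \<Rightarrow> real) \<Rightarrow> real set \<Rightarrow> (real \<Rightarrow> real measure) \<Rightarrow> bool" where
  "has_cond_distr_on M Y X S K \<longleftrightarrow>
     K \<in> restrict_space borel S \<rightarrow>\<^sub>M prob_algebra borel \<and>
     (\<forall>A\<in>sets borel. \<forall>B\<in>sets borel. A \<subseteq> S \<longrightarrow>
        emeasure M {w \<in> space M. X w \<in> A \<and> Y w \<in> B} =
        (\<integral>\<^sup>+x\<in>A. emeasure (K x) B \<partial>distr M borel X))"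

definition exponential_law :: "real \<Rightarrow> real measure" where
  "exponential_law r = density lborel (\<lambda>t. ennreal (exponential_density r t))"

text \<open>
  Density of the second coordinate given that the first one equals \<open>t\<close>, computed from a joint
  density \<open>f\<close>.
\<close>

definition cond_density :: "(real \<Rightarrow> real \<Rightarrow> real) \<Rightarrow> real \<Rightarrow> real \<Rightarrow> real" where
  "cond_density f t x = f t x / (LBINT y. f t y)"

definition cond_density_law :: "(real \<Rightarrow> real \<Rightarrow> real) \<Rightarrow> real \<Rightarrow> real measure" where
  "cond_density_law f t = density lborel (\<lambda>x. ennreal (cond_density f t x))"

abbreviation generated_by :: "'a measure \<Rightarrow> ('a \<Rightarrow> real) \<Rightarrow> 'a measure" where
  "generated_by M X \<equiv> vimage_algebra (space M) X borel"

definition exp_min_u_exp_regression :: "real \<Rightarrow> real \<Rightarrow> real \<Rightarrow> real" where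
  "exp_min_u_exp_regression a l t =
     (2 * (t - 2 * l) + 2 * a * l * (t + l)
        - exp (- a * (l + t))
          * (a\<^sup>2 * t * (l + t)\<^sup>2 + 2 * a * (t\<^sup>2 - l\<^sup>2) + 2 * (t - 2 * l)))
     / (a * l * (l + t)\<^sup>2 + (t\<^sup>2 - l\<^sup>2) * (1 - exp (- a * (l + t)))
        - a * t * (l + t)\<^sup>2 * exp (- a * (l + t)))"

end

theory Submission
  imports Defs
begin

text \<open>
  The law of \<open>\<xi>\<close> has density \<open>f x = e\<^bsup>-lx\<^esup> (1 + la - lx) / a\<close> on \<open>(0, a)\<close>, and integrating the
  exponential kernel against it gives the joint density
  \<open>h t x = x e\<^bsup>-(l + t)x\<^esup> (1 + la - lx) / a\<close> of \<open>(\<tau>, \<xi>)\<close>.  Since \<open>\<eta> / x\<close> is exponential with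
  rate \<open>x\<close>, the pair \<open>(\<eta> / \<xi>, \<xi>)\<close> satisfies the hypotheses imposed on \<open>(\<tau>, \<xi>)\<close>, so the two
  pairs have the same joint law.  Everything else is read off from \<open>f\<close> and \<open>h\<close>: the marginal density
  of \<open>\<tau>\<close> and the regression of \<open>\<xi>\<close> on \<open>\<tau>\<close> are elementary integrals of \<open>h t x\<close> and
  \<open>x h t x\<close> over \<open>(0, a)\<close>, and \<open>E(\<tau>\<^sup>p | \<xi> = x) = \<Gamma>(p + 1) x\<^bsup>-p\<^esup>\<close>, which is infinite for
  \<open>p \<le> -1\<close> and whose integral against \<open>f\<close> diverges at \<open>0\<close> for \<open>p \<ge> 1\<close>.
\<close>

section \<open>Densities, kernels and joint laws\<close>

text \<open>The densities are cut off by strict inequalities, whereas the fundamental theorem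
  integrates over a closed interval. The two integrands differ at most at the end points, a null
  set.\<close>

lemma has_bochner_integral_FTC_real_ae:
  fixes f F g :: "real \<Rightarrow> real"
  assumes "a \<le> b"
    and "\<And>x. a \<le> x \<Longrightarrow> x \<le> b \<Longrightarrow> (F has_real_derivative f x) (at x)"
    and "\<And>x. a \<le> x \<Longrightarrow> x \<le> b \<Longrightarrow> isCont f x"
    and g: "\<And>x. x \<noteq> a \<Longrightarrow> x \<noteq> b \<Longrightarrow> g x = f x * indicator {a..b} x"
    and [measurable]: "g \<in> borel_measurable borel"
  shows "has_bochner_integral lborel g (F b - F a)"
proof -
  have *: "has_bochner_integral lborel (\<lambda>x. f x * indicator {a..b} x) (F b - F a)"
    by (rule has_bochner_integral_FTC_Icc_real) (use assms in auto)
  have "AE x in lborel. f x * indicator {a..b} x = g x"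
    using AE_lborel_singleton[of a] AE_lborel_singleton[of b] by eventually_elim (simp add: g)
  moreover have "(\<lambda>x. f x * indicator {a..b} x) \<in> borel_measurable lborel"
    using * by (auto simp: has_bochner_integral_iff)
  ultimately show ?thesis
    using * by (subst (asm) has_bochner_integral_cong_AE) auto
qed

lemma nn_integral_eq_has_bochner_integral:
  fixes f :: "'a \<Rightarrow> real"
  assumes "has_bochner_integral M f v" "\<And>x. 0 \<le> f x"
  shows "(\<integral>\<^sup>+x. ennreal (f x) \<partial>M) = ennreal v"
  using assms by (auto simp: has_bochner_integral_iff nn_integral_eq_integral)

lemma cdf_density_lborel:
  fixes f :: "real \<Rightarrow> real"
  assumes [measurable]: "f \<in> borel_measurable borel" and nn: "\<And>x. 0 \<le> f x"
    and "has_bochner_integral lborel (\<lambda>y. f y * indicator {..x} y) v"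
  shows "cdf (density lborel f) x = v"
proof -
  have "emeasure (density lborel f) {..x} = (\<integral>\<^sup>+y. ennreal (f y * indicator {..x} y) \<partial>lborel)"
    by (subst emeasure_density) (auto intro!: nn_integral_cong split: split_indicator)
  also have "\<dots> = ennreal v"
    by (rule nn_integral_eq_has_bochner_integral[OF assms(3)]) (simp add: nn)
  finally have "emeasure (density lborel f) {..x} = ennreal v" .
  moreover have "0 \<le> v"
    unfolding has_bochner_integral_integral_eq[OF assms(3), symmetric] by (rule Bochner_Integration.integral_nonneg) (simp add: nn)
  ultimately show ?thesis
    by (simp add: cdf_def measure_def)
qed

text \<open>A finite Borel measure on the line is determined by its cdf. This turns the cdf in
  \<open>min_u_exp_distributed\<close> into a density; integrability of \<open>f\<close> makes the
  candidate measure finite.\<close>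

lemma distr_eq_density_lborelI:
  fixes f :: "real \<Rightarrow> real"
  assumes "prob_space M" and [measurable]: "X \<in> borel_measurable M" "f \<in> borel_measurable borel"
    and nn: "\<And>x. 0 \<le> f x" and int: "integrable lborel f"
    and cdf: "\<And>x. has_bochner_integral lborel (\<lambda>y. f y * indicator {..x} y) (cdf (distr M borel X) x)"
  shows "distr M borel X = density lborel f"
proof (rule cdf_unique')
  interpret prob_space M by fact
  show "finite_borel_measure (distr M borel X)"
    by (simp add: real_distribution.finite_borel_measure_M)
  have "(\<integral>\<^sup>+x. ennreal (f x) \<partial>lborel) \<noteq> \<infinity>"
    using int nn by (simp add: nn_integral_eq_integral)
  then show "finite_borel_measure (density lborel f)"
    by (auto simp: finite_borel_measure_def finite_borel_measure_axioms_def emeasure_density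
        intro!: finite_measureI)
  show "cdf (distr M borel X) = cdf (density lborel f)"
    by (intro ext cdf_density_lborel[symmetric] nn cdf) auto
qed

text \<open>Measurability into \<open>prob_algebra\<close> need only be tested on an
  intersection-stable generator. With all Borel sets as generator it becomes measurability of a
  parameter integral. The source is restricted to \<open>S\<close> because total mass one is assumed
  only there.\<close>

lemma measurable_density_kernel:
  fixes k :: "real \<Rightarrow> real \<Rightarrow> ennreal"
  assumes k[measurable]: "case_prod k \<in> borel_measurable (borel \<Otimes>\<^sub>M borel)"
    and "\<And>x. x \<in> S \<Longrightarrow> prob_space (density lborel (k x))"
  shows "(\<lambda>x. density lborel (k x)) \<in> restrict_space borel S \<rightarrow>\<^sub>M prob_algebra borel"
proof (rule measurable_prob_algebra_generated[where \<Omega>=UNIV and G="sets borel"])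
  show "sets borel = sigma_sets UNIV (sets (borel :: real measure))"
    using sets.sigma_sets_eq[of "borel :: real measure"] by simp
  show "Int_stable (sets (borel :: real measure))"
    by (rule sets.Int_stable)
  fix A :: "real set" assume [measurable]: "A \<in> sets borel"
  have [measurable]: "k x \<in> borel_measurable borel" for x
    using measurable_compose[OF measurable_Pair1'[of x borel borel] k] by simp
  have "(\<lambda>x. \<integral>\<^sup>+t. k x t * indicator A t \<partial>lborel) \<in> borel_measurable borel"
    by measurable
  then show "(\<lambda>x. emeasure (density lborel (k x)) A) \<in> borel_measurable (restrict_space borel S)"
    by (intro measurable_restrict_space1) (simp add: emeasure_density)
qed (use assms in \<open>auto simp: space_restrict_space\<close>)

text \<open>\<open>has_cond_distr_on\<close> fixes the joint law on rectangles whose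
  \<open>X\<close> side lies in \<open>S\<close>. Since \<open>f\<close> vanishes off
  \<open>S\<close>, almost every value of \<open>X\<close> is in \<open>S\<close>, so every
  rectangle is covered, and rectangles form an intersection-stable generator.\<close>

lemma joint_law_of_cond_distr:
  fixes X Y :: "'a \<Rightarrow> real"
  assumes "prob_space M" and [measurable]: "X \<in> borel_measurable M" "Y \<in> borel_measurable M"
    and [measurable]: "f \<in> borel_measurable borel" and S[measurable]: "S \<in> sets borel"
    and k[measurable]: "case_prod k \<in> borel_measurable (borel \<Otimes>\<^sub>M borel)"
    and X: "distr M borel X = density lborel f"
    and f0: "\<And>x. x \<notin> S \<Longrightarrow> f x = 0"
    and cond: "has_cond_distr_on M Y X S (\<lambda>x. density lborel (k x))"
  shows "distr M (borel \<Otimes>\<^sub>M borel) (\<lambda>w. (Y w, X w)) =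
    density (lborel \<Otimes>\<^sub>M lborel) (\<lambda>(t, x). f x * k x t)"
proof -
  interpret prob_space M by fact
  let ?E = "{a \<times> b | a b. a \<in> sets (borel :: real measure) \<and> b \<in> sets (borel :: real measure)}"
  have [measurable]: "k x \<in> borel_measurable borel" for x
    using measurable_compose[OF measurable_Pair1'[of x borel borel] k] by simp
  have "x \<in> S" if "0 < f x" for x
    using f0[of x] that by (cases "x \<in> S") auto
  then have "AE x in density lborel f. x \<in> S"
    by (subst AE_density) auto
  then have AES: "AE w in M. X w \<in> S"
    unfolding X[symmetric] by (subst (asm) AE_distr_iff) auto
  have sets: "sets (borel \<Otimes>\<^sub>M borel :: (real \<times> real) measure) = sigma_sets UNIV ?E"
    using sets_pair_measure[of "borel :: real measure" "borel :: real measure"] by simp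
  show ?thesis
  proof (rule measure_eqI_generator_eq[where E="?E" and \<Omega>=UNIV and A="\<lambda>_. UNIV"])
    show "Int_stable ?E" by (rule Int_stable_pair_measure_generator)
    fix R assume "R \<in> ?E"
    then obtain B A where R: "R = B \<times> A" and [measurable]: "B \<in> sets borel" "A \<in> sets borel"
      by auto
    have "emeasure (distr M (borel \<Otimes>\<^sub>M borel) (\<lambda>w. (Y w, X w))) R
        = emeasure M {w \<in> space M. X w \<in> A \<and> Y w \<in> B}"
      by (subst emeasure_distr) (auto simp: R intro!: arg_cong[where f="emeasure M"])
    also have "\<dots> = emeasure M {w \<in> space M. X w \<in> A \<inter> S \<and> Y w \<in> B}"
      using AES by (intro emeasure_eq_AE) auto
    also have "\<dots> = (\<integral>\<^sup>+x\<in>A \<inter> S. emeasure (density lborel (k x)) B \<partial>density lborel f)"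
      using cond unfolding has_cond_distr_on_def X by (auto simp del: Int_iff)
    also have "\<dots> = (\<integral>\<^sup>+x. f x * ((\<integral>\<^sup>+t. k x t * indicator B t \<partial>lborel) * indicator (A \<inter> S) x) \<partial>lborel)"
      by (subst nn_integral_density) (auto simp: emeasure_density)
    also have "\<dots> = (\<integral>\<^sup>+x. \<integral>\<^sup>+t. f x * k x t * indicator R (t, x) \<partial>lborel \<partial>lborel)"
    proof (intro nn_integral_cong)
      fix x
      have "(\<integral>\<^sup>+t. f x * k x t * indicator R (t, x) \<partial>lborel)
         = (\<integral>\<^sup>+t. (f x * indicator A x) * (k x t * indicator B t) \<partial>lborel)"
        by (intro nn_integral_cong) (auto simp: R split: split_indicator)
      also have "\<dots> = f x * indicator A x * (\<integral>\<^sup>+t. k x t * indicator B t \<partial>lborel)"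
        by (subst nn_integral_cmult) auto
      finally show "f x * ((\<integral>\<^sup>+t. k x t * indicator B t \<partial>lborel) * indicator (A \<inter> S) x)
          = (\<integral>\<^sup>+t. f x * k x t * indicator R (t, x) \<partial>lborel)"
        using f0[of x] by (auto split: split_indicator)
    qed
    also have "\<dots> = (\<integral>\<^sup>+z. (case z of (t, x) \<Rightarrow> f x * k x t) * indicator R z \<partial>(lborel \<Otimes>\<^sub>M lborel))"
      by (subst lborel_pair.nn_integral_snd[symmetric]) (auto simp: R)
    also have "\<dots> = emeasure (density (lborel \<Otimes>\<^sub>M lborel) (\<lambda>(t, x). f x * k x t)) R"
      by (subst emeasure_density) (auto simp: R)
    finally show "emeasure (distr M (borel \<Otimes>\<^sub>M borel) (\<lambda>w. (Y w, X w))) R =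
      emeasure (density (lborel \<Otimes>\<^sub>M lborel) (\<lambda>(t, x). f x * k x t)) R" .
  next
    show "emeasure (distr M (borel \<Otimes>\<^sub>M borel) (\<lambda>w. (Y w, X w))) UNIV \<noteq> \<infinity>"
      unfolding infinity_ennreal_def
      by (rule finite_measure.emeasure_finite[OF prob_space.finite_measure, OF prob_space_distr]) measurable
    have "(UNIV \<times> UNIV :: (real \<times> real) set) \<in> ?E"
      by (intro CollectI exI[of _ UNIV]) simp
    then show "range (\<lambda>_::nat. UNIV) \<subseteq> ?E" by simp
    show "sets (density (lborel \<Otimes>\<^sub>M lborel) (\<lambda>(t, x). f x * k x t)) = sigma_sets UNIV ?E"
      unfolding sets[symmetric] sets_density by (intro sets_pair_measure_cong) auto
  qed (use sets in auto)
qed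

lemma sigma_finite_subalgebra_generated_by:
  assumes "prob_space M" and [measurable]: "X \<in> borel_measurable M"
  shows "sigma_finite_subalgebra M (generated_by M X)"
proof (rule finite_measure_subalgebra_is_sigma_finite)
  interpret prob_space M by fact
  show "finite_measure_subalgebra M (generated_by M X)"
    by unfold_locales (auto simp: subalgebra_def sets_vimage_algebra2)
qed

section \<open>The exponential kernel\<close>

lemma exponential_law_measurable:
  "exponential_law \<in> restrict_space borel {0<..} \<rightarrow>\<^sub>M prob_algebra borel"
  unfolding exponential_law_def
proof (rule measurable_density_kernel)
  show "(\<lambda>(x, t). ennreal (exponential_density x t)) \<in> borel_measurable (borel \<Otimes>\<^sub>M borel)"
    unfolding exponential_density_def split_beta by measurable
qed (auto intro: prob_space_exponential_density)

text \<open>Scaling: by the substitution y = x t, a unit exponential variable divided by the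
  constant x is exponential with rate x.\<close>

lemma emeasure_exponential_law:
  assumes x: "0 < x" and [measurable]: "B \<in> sets borel"
  shows "emeasure (exponential_law x) B = (\<integral>\<^sup>+y. indicator B (y / x) \<partial>exponential_law 1)"
proof -
  have "(\<integral>\<^sup>+y. indicator B (y / x) \<partial>exponential_law 1)
      = (\<integral>\<^sup>+y. ennreal (exponential_density 1 y) * indicator B (y / x) \<partial>lborel)"
    unfolding exponential_law_def by (subst nn_integral_density) auto
  \<comment> \<open>The summand 0 is the offset of the affine substitution in
    \<open>nn_integral_real_affine\<close>.\<close>
  also have "\<dots> = ennreal \<bar>x\<bar> * (\<integral>\<^sup>+t. ennreal (exponential_density 1 (0 + x * t)) * indicator B ((0 + x * t) / x) \<partial>lborel)"
    using x by (intro nn_integral_real_affine) auto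
  also have "\<dots> = (\<integral>\<^sup>+t. ennreal x * (ennreal (exponential_density 1 (x * t)) * indicator B t) \<partial>lborel)"
    using x by (subst nn_integral_cmult) auto
  also have "\<dots> = (\<integral>\<^sup>+t. ennreal (exponential_density x t) * indicator B t \<partial>lborel)"
    using x by (intro nn_integral_cong)
      (auto simp: exponential_density_def ennreal_mult[symmetric] mult_less_0_iff mult_ac split: split_indicator)
  also have "\<dots> = emeasure (exponential_law x) B"
    unfolding exponential_law_def by (subst emeasure_density) auto
  finally show ?thesis ..
qed

text \<open>Independence makes the law of (\<xi>, \<eta>) a product, so by Fubini \<xi> can be
  frozen at a value x and the scaling of the exponential law applied to \<eta> / x. Only x > 0
  occurs, because \<open>A\<close> lies in \<open>{0<..}\<close>.\<close>

lemma has_cond_distr_on_exponential_quotient: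
  assumes "prob_space N" and eta: "distributed N lborel \<eta> (\<lambda>y. ennreal (exponential_density 1 y))"
    and ind: "prob_space.indep_var N borel \<xi> borel \<eta>"
  shows "has_cond_distr_on N (\<lambda>w. \<eta> w / \<xi> w) \<xi> {0<..} exponential_law"
  unfolding has_cond_distr_on_def
proof (intro conjI ballI impI)
  interpret prob_space N by fact
  have [measurable]: "\<xi> \<in> borel_measurable N" "\<eta> \<in> borel_measurable N"
    and prod: "distr N borel \<xi> \<Otimes>\<^sub>M distr N borel \<eta> = distr N (borel \<Otimes>\<^sub>M borel) (\<lambda>w. (\<xi> w, \<eta> w))"
    using ind unfolding indep_var_distribution_eq by auto
  have law: "distr N borel \<eta> = exponential_law 1"
    using eta by (auto simp: distributed_def exponential_law_def cong: distr_cong)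
  interpret eta: prob_space "distr N borel \<eta>" by (rule prob_space_distr) simp
  fix A B :: "real set" assume [measurable]: "A \<in> sets borel" "B \<in> sets borel" and A: "A \<subseteq> {0<..}"
  have "emeasure N {w \<in> space N. \<xi> w \<in> A \<and> \<eta> w / \<xi> w \<in> B}
     = (\<integral>\<^sup>+w. indicator {w \<in> space N. \<xi> w \<in> A \<and> \<eta> w / \<xi> w \<in> B} w \<partial>N)"
    by (rule nn_integral_indicator[symmetric]) measurable
  also have "\<dots> = (\<integral>\<^sup>+w. indicator A (\<xi> w) * indicator B (\<eta> w / \<xi> w) \<partial>N)"
    by (intro nn_integral_cong) (auto split: split_indicator)
  also have "\<dots> = (\<integral>\<^sup>+z. indicator A (fst z) * indicator B (snd z / fst z) \<partial>(distr N borel \<xi> \<Otimes>\<^sub>M distr N borel \<eta>))"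
    unfolding prod by (subst nn_integral_distr) auto
  also have "\<dots> = (\<integral>\<^sup>+x. \<integral>\<^sup>+y. indicator A x * indicator B (y / x) \<partial>distr N borel \<eta> \<partial>distr N borel \<xi>)"
    by (subst eta.nn_integral_fst[symmetric]) auto
  also have "\<dots> = (\<integral>\<^sup>+x\<in>A. emeasure (exponential_law x) B \<partial>distr N borel \<xi>)"
  proof (intro nn_integral_cong)
    fix x
    show "(\<integral>\<^sup>+y. indicator A x * indicator B (y / x) \<partial>distr N borel \<eta>)
        = emeasure (exponential_law x) B * indicator A x"
      using A emeasure_exponential_law[of x B] by (auto simp: law split: split_indicator)
  qed
  finally show "emeasure N {w \<in> space N. \<xi> w \<in> A \<and> \<eta> w / \<xi> w \<in> B}
     = (\<integral>\<^sup>+x\<in>A. emeasure (exponential_law x) B \<partial>distr N borel \<xi>)" .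
qed (rule exponential_law_measurable)

section \<open>Power moments of the exponential law\<close>

lemma nn_integral_powr_exponential_law:
  assumes x: "0 < x" and p: "- 1 < p"
  shows "(\<integral>\<^sup>+t. ennreal (t powr p) \<partial>exponential_law x) = ennreal (Gamma (p + 1) * x powr (- p))"
proof -
  let ?I = "\<integral>\<^sup>+t. ennreal (t powr p) \<partial>exponential_law x"
  have "ennreal (Gamma (p + 1)) = (\<integral>\<^sup>+u. ennreal (indicator {0..} u * u powr p / exp u) \<partial>lborel)"
    using Gamma_conv_nn_integral_real[of "p + 1"] p by simp
  \<comment> \<open>Substituting u = x t in the Gamma integral; the Jacobian x together with exp(- x
    t) forms the exponential density, and the power contributes the factor
    \<open>x powr p\<close>.\<close>
  also have "\<dots> = ennreal \<bar>x\<bar> * (\<integral>\<^sup>+t. ennreal (indicator {0..} (0 + x * t) * (0 + x * t) powr p / exp (0 + x * t)) \<partial>lborel)"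
    using x by (intro nn_integral_real_affine) auto
  also have "\<dots> = (\<integral>\<^sup>+t. ennreal x * ennreal (indicator {0..} (0 + x * t) * (0 + x * t) powr p / exp (0 + x * t)) \<partial>lborel)"
    using x by (subst nn_integral_cmult) auto
  also have "\<dots> = (\<integral>\<^sup>+t. ennreal (x powr p) * (ennreal (exponential_density x t) * ennreal (t powr p)) \<partial>lborel)"
    using x by (intro nn_integral_cong)
      (auto simp: exponential_density_def ennreal_mult[symmetric] zero_le_mult_iff powr_mult exp_minus field_simps
        split: split_indicator)
  also have "\<dots> = ennreal (x powr p) * ?I"
    unfolding exponential_law_def by (subst nn_integral_density) (auto simp: nn_integral_cmult)
  \<comment> \<open>Finiteness of \<open>?I\<close> is not known yet, so it is isolated by
    multiplying with the finite positive number \<open>x powr (- p)\<close> instead of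
    cancelling.\<close>
  finally have "ennreal (x powr (- p)) * ennreal (Gamma (p + 1)) = ennreal (x powr (- p)) * (ennreal (x powr p) * ?I)"
    by simp
  also have "\<dots> = ?I"
    using x by (simp add: mult.assoc[symmetric] ennreal_mult[symmetric] powr_minus)
  finally show ?thesis
    using p by (simp add: ennreal_mult mult.commute)
qed

text \<open>Close to 0 the power dominates 1/t, whose integral diverges logarithmically.\<close>

lemma nn_integral_powr_divergent:
  fixes p c :: real
  assumes c: "0 < c" and p: "p \<le> - 1"
  shows "(\<integral>\<^sup>+t. ennreal (t powr p) * indicator {0<..<c} t \<partial>lborel) = \<infinity>"
proof (rule ccontr)
  \<comment> \<open>The cap at 1 guarantees 1/t \<le> \<open>t powr p\<close> on the range
    considered, as p \<le> -1.\<close>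
  define b where "b = min c 1"
  have b: "0 < b" "b \<le> c" "b \<le> 1" using c by (auto simp: b_def)
  assume "\<not> ?thesis"
  then obtain n :: nat where n: "(\<integral>\<^sup>+t. ennreal (t powr p) * indicator {0<..<c} t \<partial>lborel) < of_nat n"
    using ennreal_Ex_less_of_nat[of "\<integral>\<^sup>+t. ennreal (t powr p) * indicator {0<..<c} t \<partial>lborel"]
    by (auto simp: less_top)
  \<comment> \<open>Chosen so that the integral of 1/t over [d, b] is exactly \<open>n\<close>, a
    number exceeding the supposedly finite integral.\<close>
  define d where "d = b * exp (- real n)"
  have d: "0 < d" "d \<le> b" using b by (auto simp: d_def)
  have "(\<integral>\<^sup>+t. ennreal (1 / t) * indicator {d..b} t \<partial>lborel) = ennreal (ln b - ln d)"
    using d by (intro nn_integral_FTC_Icc) (auto intro!: derivative_eq_intros)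
  also have "ln b - ln d = real n"
    using b by (simp add: d_def ln_mult)
  finally have "of_nat n = (\<integral>\<^sup>+t. ennreal (1 / t) * indicator {d..b} t \<partial>lborel)"
    by (simp add: ennreal_of_nat_eq_real_of_nat)
  also have "\<dots> \<le> (\<integral>\<^sup>+t. ennreal (t powr p) * indicator {0<..<c} t \<partial>lborel)"
  proof (intro nn_integral_mono_AE)
    \<comment> \<open>The closed interval ends at \<open>b\<close>, which may coincide with the
      excluded point \<open>c\<close>; that single point is discarded as null.\<close>
    show "AE t in lborel. ennreal (1 / t) * indicator {d..b} t \<le> ennreal (t powr p) * indicator {0<..<c} t"
      using AE_lborel_singleton[of c]
    proof eventually_elim
      fix t assume "t \<noteq> c"
      have "1 / t \<le> t powr p" if "d \<le> t" "t \<le> b"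
      proof -
        have "1 / t = t powr (- 1)" using that d by (simp add: powr_minus_divide)
        also have "\<dots> \<le> t powr p" using that d b p by (intro powr_mono') auto
        finally show ?thesis .
      qed
      then show "ennreal (1 / t) * indicator {d..b} t \<le> ennreal (t powr p) * indicator {0<..<c} t"
        using d b \<open>t \<noteq> c\<close> by (auto intro!: ennreal_leI split: split_indicator)
    qed
  qed
  finally show False using n by simp
qed

text \<open>On (0, 1) the exponential density is at least \<open>x * exp (- x)\<close>, so the
  divergence of the bare power at 0 carries over.\<close>

lemma nn_integral_powr_exponential_law_divergent:
  assumes x: "0 < x" and p: "p \<le> - 1"
  shows "(\<integral>\<^sup>+t. ennreal (t powr p) \<partial>exponential_law x) = \<infinity>"
proof -
  have "\<infinity> = ennreal (x * exp (- x)) * (\<integral>\<^sup>+t. ennreal (t powr p) * indicator {0<..<1} t \<partial>lborel)"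
    using x nn_integral_powr_divergent[OF _ p, of 1] by (simp add: ennreal_mult_top)
  also have "\<dots> = (\<integral>\<^sup>+t. ennreal (x * exp (- x)) * (ennreal (t powr p) * indicator {0<..<1} t) \<partial>lborel)"
    by (subst nn_integral_cmult) auto
  also have "\<dots> \<le> (\<integral>\<^sup>+t. ennreal (exponential_density x t) * ennreal (t powr p) \<partial>lborel)"
    using x by (intro nn_integral_mono)
      (auto simp: exponential_density_def intro!: mult_right_mono ennreal_leI split: split_indicator)
  also have "\<dots> = (\<integral>\<^sup>+t. ennreal (t powr p) \<partial>exponential_law x)"
    unfolding exponential_law_def by (subst nn_integral_density) auto
  finally show ?thesis by (simp add: top_unique)
qed

text \<open>The power moment with p = 1. The identification of \<open>t powr 1\<close> with
  \<open>t\<close> is made for t \<ge> 0, which is almost everywhere under the exponential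
  law.\<close>

lemma exponential_law_mean:
  assumes x: "0 < x"
  shows "has_bochner_integral (exponential_law x) (\<lambda>t. t) (1 / x)"
    and nn_integral_exponential_law_id: "(\<integral>\<^sup>+t. ennreal t \<partial>exponential_law x) = ennreal (1 / x)"
proof -
  have AE: "AE t in exponential_law x. 0 \<le> t"
    unfolding exponential_law_def by (subst AE_density) (auto simp: exponential_density_def)
  have "(\<integral>\<^sup>+t. ennreal t \<partial>exponential_law x) = (\<integral>\<^sup>+t. ennreal (t powr 1) \<partial>exponential_law x)"
    using AE by (intro nn_integral_cong_AE) (auto elim!: eventually_mono)
  also have "\<dots> = ennreal (1 / x)"
    using x Gamma_fact[of 1, where 'a=real] by (subst nn_integral_powr_exponential_law) (auto simp: powr_minus_divide)
  finally show *: "(\<integral>\<^sup>+t. ennreal t \<partial>exponential_law x) = ennreal (1 / x)" .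
  show "has_bochner_integral (exponential_law x) (\<lambda>t. t) (1 / x)"
    using x AE * by (intro has_bochner_integral_nn_integral) (auto simp: exponential_law_def)
qed

section \<open>Min-U-Exp and Exp-Min-U-Exp densities\<close>

definition min_u_exp_density :: "real \<Rightarrow> real \<Rightarrow> real \<Rightarrow> real" where
  "min_u_exp_density a l x = (if 0 < x \<and> x < a then exp (- l * x) / a * (1 + l * a - l * x) else 0)"

text \<open>The derivative of \<open>exp_min_u_exp_cdf\<close> on t > 0, put over a common
  denominator so that its numerator is the denominator of the conditional density of \<xi> given
  \<tau>.\<close>

definition exp_min_u_exp_density :: "real \<Rightarrow> real \<Rightarrow> real \<Rightarrow> real" where
  "exp_min_u_exp_density a l t =
     (if 0 < t
      then (a * l * (l + t) + (t - l) * (1 - exp (- a * (l + t))) - a * t * (l + t) * exp (- a * (l + t)))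
        / (a * (l + t) ^ 3)
      else 0)"

lemma borel_measurable_min_u_exp_density [measurable]:
  "min_u_exp_density a l \<in> borel_measurable borel"
  unfolding min_u_exp_density_def[abs_def] by measurable

lemma borel_measurable_exp_min_u_exp_density [measurable]:
  "exp_min_u_exp_density a l \<in> borel_measurable borel"
  unfolding exp_min_u_exp_density_def[abs_def] by measurable

lemma borel_measurable_exp_min_u_exp_regression [measurable]:
  "exp_min_u_exp_regression a l \<in> borel_measurable borel"
  unfolding exp_min_u_exp_regression_def[abs_def] by measurable

lemma borel_measurable_biv_exp_min_u_exp_density [measurable]:
  "(\<lambda>(t, x). biv_exp_min_u_exp_density a l t x) \<in> borel_measurable (borel \<Otimes>\<^sub>M borel)"
  "biv_exp_min_u_exp_density a l t \<in> borel_measurable borel"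
  unfolding biv_exp_min_u_exp_density_def[abs_def] split_beta by measurable

context
  fixes a l :: real
  assumes a: "0 < a" and l: "0 < l"
begin

lemma min_u_exp_factor_pos:
  assumes "x \<le> a"
  shows "0 < 1 + l * a - l * x"
  using mult_left_mono[OF assms, of l] l by linarith

lemma min_u_exp_density_nonneg: "0 \<le> min_u_exp_density a l x"
  using min_u_exp_factor_pos[of x] a by (auto simp: min_u_exp_density_def)

lemma biv_exp_min_u_exp_density_nonneg: "0 \<le> biv_exp_min_u_exp_density a l t x"
  using min_u_exp_factor_pos[of x] a by (auto simp: biv_exp_min_u_exp_density_def)

lemma has_bochner_integral_min_u_exp_density_atMost:
  "has_bochner_integral lborel (\<lambda>y. min_u_exp_density a l y * indicator {..x} y) (min_u_exp_cdf a l x)"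
proof (cases "x \<le> 0")
  case True
  then have "(\<lambda>y. min_u_exp_density a l y * indicator {..x} y) = (\<lambda>_. 0)"
    by (auto simp: min_u_exp_density_def split: split_indicator)
  with True show ?thesis
    by (simp add: min_u_exp_cdf_def has_bochner_integral_zero)
next
  case False
  let ?F = "\<lambda>y. 1 - exp (- l * y) + y / a * exp (- l * y)"
  \<comment> \<open>The middle branch of the cdf already equals 1 at a, so there is no atom, and
    stopping the antiderivative at \<open>min x a\<close> serves both x \<le> a and x > a.\<close>
  have "has_bochner_integral lborel (\<lambda>y. min_u_exp_density a l y * indicator {..x} y) (?F (min x a) - ?F 0)"
  proof (rule has_bochner_integral_FTC_real_ae[where F="?F" and f="\<lambda>y. exp (- l * y) / a * (1 + l * a - l * y)"])
    show "(?F has_real_derivative exp (- l * y) / a * (1 + l * a - l * y)) (at y)" for y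
      using a by (auto intro!: derivative_eq_intros simp: field_simps)
    show "isCont (\<lambda>y. exp (- l * y) / a * (1 + l * a - l * y)) y" for y
      using a by (intro continuous_intros) auto
    show "min_u_exp_density a l y * indicator {..x} y
        = exp (- l * y) / a * (1 + l * a - l * y) * indicator {0..min x a} y"
      if "y \<noteq> 0" "y \<noteq> min x a" for y
      using that by (auto simp: min_u_exp_density_def min_def split: split_indicator if_splits)
  qed (use False a in auto)
  also have "?F (min x a) - ?F 0 = min_u_exp_cdf a l x"
    using False a by (auto simp: min_u_exp_cdf_def min_def)
  finally show ?thesis .
qed

lemma has_bochner_integral_min_u_exp_density:
  "has_bochner_integral lborel (min_u_exp_density a l) 1"
proof -
  have "(\<lambda>y. min_u_exp_density a l y * indicator {..a + 1} y) = min_u_exp_density a l"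
    by (auto simp: min_u_exp_density_def split: split_indicator)
  then show ?thesis
    using has_bochner_integral_min_u_exp_density_atMost[of "a + 1"] a by (simp add: min_u_exp_cdf_def)
qed

lemma min_u_exp_law:
  assumes "prob_space M" "min_u_exp_distributed M a l X"
  shows "distr M borel X = density lborel (min_u_exp_density a l)"
proof (rule distr_eq_density_lborelI)
  show "integrable lborel (min_u_exp_density a l)"
    using has_bochner_integral_min_u_exp_density by (simp add: has_bochner_integral_iff)
  show "has_bochner_integral lborel (\<lambda>y. min_u_exp_density a l y * indicator {..x} y) (cdf (distr M borel X) x)" for x
    using assms has_bochner_integral_min_u_exp_density_atMost[of x] by (simp add: min_u_exp_distributed_def)
qed (use assms in \<open>simp_all add: min_u_exp_distributed_def min_u_exp_density_nonneg\<close>)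

section \<open>Integrals of the joint density and the law they give\<close>

lemma has_bochner_integral_biv_density:
  assumes t: "0 < t"
  shows "has_bochner_integral lborel (biv_exp_min_u_exp_density a l t) (exp_min_u_exp_density a l t)"
proof -
  define s where "s = l + t"
  \<comment> \<open>Eliminating t in favour of s leaves only powers of s, besides a, in the
    denominators, so the final identity is polynomial in s, l, a and one exponential.\<close>
  have s: "0 < s" "t = s - l" using t l by (auto simp: s_def)
  \<comment> \<open>Integration by parts: 1 + s x and 2 + 2 s x + (s x)^2 are the polynomials in the
    antiderivatives of x exp(- s x) and x^2 exp(- s x).\<close>
  define F where "F = (\<lambda>x. - exp (- s * x) / (a * s ^ 3) *
    ((1 + l * a) * s * (1 + s * x) - l * (2 + 2 * s * x + s\<^sup>2 * x\<^sup>2)))"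
  have "has_bochner_integral lborel (biv_exp_min_u_exp_density a l t) (F a - F 0)"
  proof (rule has_bochner_integral_FTC_real_ae[where F=F and f="\<lambda>x. 1 / a * x * exp (- s * x) * (1 + l * a - l * x)"])
    show "(F has_real_derivative 1 / a * x * exp (- s * x) * (1 + l * a - l * x)) (at x)" for x
      unfolding F_def using a s by (auto intro!: derivative_eq_intros) (simp add: field_simps power2_eq_square power3_eq_cube)
    show "isCont (\<lambda>x. 1 / a * x * exp (- s * x) * (1 + l * a - l * x)) x" for x
      using a by (intro continuous_intros) auto
  qed (use a t in \<open>auto simp: biv_exp_min_u_exp_density_def s_def split: split_indicator\<close>)
  also have "F a - F 0 = exp_min_u_exp_density a l t"
    unfolding exp_min_u_exp_density_def F_def s_def[symmetric]
    using a s t by (simp add: divide_simps mult.commute[of s a]) (simp add: algebra_simps power2_eq_square power3_eq_cube)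
  finally show ?thesis .
qed

text \<open>The numerator obtained here is that of \<open>exp_min_u_exp_regression\<close>; relating
  the denominators is left until the marginal density is known to be nonzero.\<close>

lemma has_bochner_integral_biv_density_moment_explicit:
  assumes t: "0 < t"
  shows "has_bochner_integral lborel (\<lambda>x. x * biv_exp_min_u_exp_density a l t x)
    ((2 * (t - 2 * l) + 2 * a * l * (t + l) - exp (- a * (l + t))
          * (a\<^sup>2 * t * (l + t)\<^sup>2 + 2 * a * (t\<^sup>2 - l\<^sup>2) + 2 * (t - 2 * l))) / (a * (l + t) ^ 4))"
proof -
  define s where "s = l + t"
  have s: "0 < s" "t = s - l" using t l by (auto simp: s_def)
  \<comment> \<open>As for the plain integral, one degree higher: the cubic polynomial belongs to
    the antiderivative of x^3 exp(- s x).\<close>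
  define F where "F = (\<lambda>x. - exp (- s * x) / (a * s ^ 4) *
    ((1 + l * a) * s * (2 + 2 * s * x + s\<^sup>2 * x\<^sup>2) - l * (6 + 6 * s * x + 3 * s\<^sup>2 * x\<^sup>2 + s ^ 3 * x ^ 3)))"
  have "has_bochner_integral lborel (\<lambda>x. x * biv_exp_min_u_exp_density a l t x) (F a - F 0)"
  proof (rule has_bochner_integral_FTC_real_ae[where F=F and f="\<lambda>x. 1 / a * x\<^sup>2 * exp (- s * x) * (1 + l * a - l * x)"])
    show "(F has_real_derivative 1 / a * x\<^sup>2 * exp (- s * x) * (1 + l * a - l * x)) (at x)" for x
      unfolding F_def using a s by (auto intro!: derivative_eq_intros) (simp add: field_simps power2_eq_square power3_eq_cube power4_eq_xxxx)
    show "isCont (\<lambda>x. 1 / a * x\<^sup>2 * exp (- s * x) * (1 + l * a - l * x)) x" for x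
      using a by (intro continuous_intros) auto
  qed (use a t in \<open>auto simp: biv_exp_min_u_exp_density_def s_def power2_eq_square split: split_indicator\<close>)
  also have "F a - F 0 = (2 * (t - 2 * l) + 2 * a * l * (t + l) - exp (- a * (l + t))
          * (a\<^sup>2 * t * (l + t)\<^sup>2 + 2 * a * (t\<^sup>2 - l\<^sup>2) + 2 * (t - 2 * l))) / (a * (l + t) ^ 4)"
    unfolding F_def s_def[symmetric]
    using a s t by (simp add: divide_simps mult.commute[of s a]) (simp add: algebra_simps power2_eq_square power3_eq_cube)
  finally show ?thesis .
qed

text \<open>The sign is hard to see from the closed formula, so it is read off from the integral:
  the integrand is nonnegative and nonzero on (0, a), a set of positive measure. This permits
  division by the marginal density.\<close>

lemma exp_min_u_exp_density_pos:
  assumes t: "0 < t"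
  shows "0 < exp_min_u_exp_density a l t"
proof -
  note int = has_bochner_integral_biv_density[OF t]
  have "0 \<le> exp_min_u_exp_density a l t"
    unfolding has_bochner_integral_integral_eq[OF int, symmetric]
    by (rule Bochner_Integration.integral_nonneg) (rule biv_exp_min_u_exp_density_nonneg)
  moreover have "exp_min_u_exp_density a l t \<noteq> 0"
  proof
    assume "exp_min_u_exp_density a l t = 0"
    then have "AE x in lborel. biv_exp_min_u_exp_density a l t x = 0"
      using int biv_exp_min_u_exp_density_nonneg
      by (intro integral_nonneg_eq_0_iff_AE[THEN iffD1]) (auto simp: has_bochner_integral_iff)
    moreover have "biv_exp_min_u_exp_density a l t x \<noteq> 0" if "x \<in> {0<..<a}" for x
      using that t a min_u_exp_factor_pos[of x] by (simp add: biv_exp_min_u_exp_density_def)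
    ultimately have "AE x in lborel. x \<notin> {0<..<a}"
      by (auto elim!: eventually_mono)
    then have "emeasure lborel {0<..<a} = 0"
      by (subst (asm) AE_iff_measurable[where N="{0<..<a}"]) auto
    with a show False by simp
  qed
  ultimately show ?thesis by simp
qed

lemma has_bochner_integral_exp_min_u_exp_density_atMost:
  "has_bochner_integral lborel (\<lambda>y. exp_min_u_exp_density a l y * indicator {..t} y) (exp_min_u_exp_cdf a l t)"
proof (cases "t \<le> 0")
  case True
  then have "(\<lambda>y. exp_min_u_exp_density a l y * indicator {..t} y) = (\<lambda>_. 0)"
    by (auto simp: exp_min_u_exp_density_def split: split_indicator)
  with True show ?thesis
    by (simp add: exp_min_u_exp_cdf_def has_bochner_integral_zero)
next
  case False
  let ?F = "\<lambda>t. t / (l + t) - t / (a * (l + t)\<^sup>2) * (1 - exp (- a * (l + t)))"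
  let ?f = "\<lambda>t. (a * l * (l + t) + (t - l) * (1 - exp (- a * (l + t))) - a * t * (l + t) * exp (- a * (l + t)))
        / (a * (l + t) ^ 3)"
  have "has_bochner_integral lborel (\<lambda>y. exp_min_u_exp_density a l y * indicator {..t} y) (?F t - ?F 0)"
  proof (rule has_bochner_integral_FTC_real_ae[where F="?F" and f="?f"])
    fix y :: real assume y: "0 \<le> y"
    define s where "s = l + y"
    \<comment> \<open>Positivity of \<open>l\<close> keeps the denominators away from 0 even at y =
      0, so the antiderivative is smooth on the closed interval.\<close>
    have s: "0 < s" "y = s - l" using y l by (auto simp: s_def)
    show "(?F has_real_derivative ?f y) (at y)"
      using a s(1) unfolding s_def
      by (auto intro!: derivative_eq_intros, unfold s_def[symmetric], simp add: divide_simps s(2),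
          simp add: algebra_simps power2_eq_square power3_eq_cube)
    show "isCont ?f y"
      using a s(1) unfolding s_def by (intro continuous_intros) auto
  qed (use False in \<open>auto simp: exp_min_u_exp_density_def split: split_indicator\<close>)
  also have "?F t - ?F 0 = exp_min_u_exp_cdf a l t"
    using False by (auto simp: exp_min_u_exp_cdf_def)
  finally show ?thesis .
qed

end

section \<open>Incomplete gamma integrals\<close>

lemma has_bochner_integral_lower_inc_gamma:
  assumes s: "0 < s"
  shows "has_bochner_integral lborel (\<lambda>u. indicator {0..y} u * (u powr (s - 1) * exp (- u))) (lower_inc_gamma s y)"
proof -
  \<comment> \<open>Finiteness of the complete Gamma integral provides the dominating function for
    the truncated one.\<close>
  have "integrable lborel (\<lambda>u::real. indicator {0..} u * u powr (s - 1) / exp u)"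
    using Gamma_conv_nn_integral_real[OF s, symmetric] by (intro integrableI_nonneg) auto
  then have "integrable lborel (\<lambda>u. indicator {0..y} u * (u powr (s - 1) * exp (- u)))"
    by (rule Bochner_Integration.integrable_bound) (auto simp: exp_minus divide_inverse split: split_indicator)
  then show ?thesis
    by (simp add: lower_inc_gamma_def has_bochner_integral_iff set_lebesgue_integral_def)
qed

text \<open>With u = l x the integrand is a multiple of (1 + l a - u) u^(-p) exp(- u) on [0, a l],
  and its two summands are incomplete gamma integrands with parameters 1 - p and 2 - p.\<close>

lemma has_bochner_integral_min_u_exp_powr:
  assumes a: "0 < a" and l: "0 < l" and p: "p < 1"
  shows "has_bochner_integral lborel (\<lambda>x. min_u_exp_density a l x * x powr (- p))
    (1 / a * l powr (p - 1) *
      ((l * a + 1) * lower_inc_gamma (1 - p) (a * l) - lower_inc_gamma (2 - p) (a * l)))"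
    (is "has_bochner_integral _ _ (1 / a * _ * ?V)")
proof -
  let ?g = "\<lambda>s u. indicator {0..a * l} u * (u powr (s - 1) * exp (- u))"
  let ?h = "\<lambda>u. (l * a + 1) * ?g (1 - p) u - ?g (2 - p) u"
  have "has_bochner_integral lborel ?h ?V"
    using p by (intro has_bochner_integral_diff has_bochner_integral_mult_right
        has_bochner_integral_lower_inc_gamma) auto
  then have "has_bochner_integral lborel (\<lambda>x. ?h (0 + l * x)) (?V /\<^sub>R \<bar>l\<bar>)"
    using l by (subst (asm) lborel_has_bochner_integral_real_affine_iff[where c=l and t=0]) auto
  \<comment> \<open>The factor \<open>l powr p\<close> undoes the l^(-p) coming from (l x)^(-p);
    with the Jacobian 1/l it leaves \<open>l powr (p - 1)\<close>.\<close>
  then have *: "has_bochner_integral lborel (\<lambda>x. (l powr p / a) * ?h (0 + l * x)) ((l powr p / a) * (?V /\<^sub>R \<bar>l\<bar>))"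
    by (rule has_bochner_integral_mult_right)
  \<comment> \<open>The closed interval of the gamma integrand and the open support of the density
    differ only at 0 and a.\<close>
  have "AE x in lborel. (l powr p / a) * ?h (0 + l * x) = min_u_exp_density a l x * x powr (- p)"
    using AE_lborel_singleton[of a] AE_lborel_singleton[of 0]
  proof eventually_elim
    fix x assume x: "x \<noteq> a" "x \<noteq> 0"
    show "(l powr p / a) * ?h (0 + l * x) = min_u_exp_density a l x * x powr (- p)"
    proof (cases "0 < x \<and> x < a")
      case True
      have "(l * x) powr (1 - p) = l * x * (l * x) powr (- p)"
        using True l powr_mult_base[of "l * x" "- p"] by simp
      moreover have "(l * x) powr (- p) = l powr (- p) * x powr (- p)"
        using True l by (simp add: powr_mult)
      moreover have "indicator {0..a * l} (l * x) = (1::real)"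
        using True l by (auto simp: indicator_def mult.commute)
      ultimately have "?h (0 + l * x) = l powr (- p) * x powr (- p) * exp (- l * x) * (1 + l * a - l * x)"
        by (simp add: algebra_simps)
      then have "(l powr p / a) * ?h (0 + l * x)
          = (l powr p / a) * (l powr (- p) * x powr (- p) * exp (- l * x) * (1 + l * a - l * x))"
        by (rule arg_cong)
      also have "\<dots> = (l powr p * l powr (- p)) * (exp (- l * x) / a * (1 + l * a - l * x) * x powr (- p))"
        by simp
      also have "\<dots> = min_u_exp_density a l x * x powr (- p)"
        using True l by (simp add: min_u_exp_density_def powr_minus)
      finally show ?thesis .
    next
      case False
      then have "indicator {0..a * l} (0 + l * x) = (0::real)"
        using x l by (auto simp: indicator_def zero_le_mult_iff)
      with False show ?thesis
        by (simp only: min_u_exp_density_def) simp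
    qed
  qed
  then have "has_bochner_integral lborel (\<lambda>x. min_u_exp_density a l x * x powr (- p)) ((l powr p / a) * (?V /\<^sub>R \<bar>l\<bar>))"
    using * by (subst (asm) has_bochner_integral_cong_AE) auto
  moreover have "(l powr p / a) * (?V /\<^sub>R \<bar>l\<bar>) = 1 / a * l powr (p - 1) * ?V"
    using l by (simp add: powr_diff field_simps)
  ultimately show ?thesis by (simp only:)
qed

section \<open>Exponential mixtures over a Min-U-Exp rate\<close>

text \<open>A locale, because it is interpreted twice: for the given pair and for the pair (\<eta> /
  \<xi>, \<xi>) on another probability space.\<close>

locale exp_min_u_exp_pair = prob_space M for M :: "'a measure" +
  fixes a l :: real and \<xi> \<tau> :: "'a \<Rightarrow> real"
  assumes a: "0 < a" and l: "0 < l"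
    and xi: "min_u_exp_distributed M a l \<xi>"
    and tau [measurable]: "\<tau> \<in> borel_measurable M"
    and cond: "has_cond_distr_on M \<tau> \<xi> {0<..} exponential_law"
begin

lemma xi_measurable [measurable]: "\<xi> \<in> borel_measurable M"
  using xi by (simp add: min_u_exp_distributed_def)

lemma joint_law_product:
  "distr M (borel \<Otimes>\<^sub>M borel) (\<lambda>w. (\<tau> w, \<xi> w)) =
    density (lborel \<Otimes>\<^sub>M lborel)
      (\<lambda>(t, x). ennreal (min_u_exp_density a l x) * ennreal (exponential_density x t))"
proof (rule joint_law_of_cond_distr[where S="{0<..}"])
  show "(\<lambda>(x, t). ennreal (exponential_density x t)) \<in> borel_measurable (borel \<Otimes>\<^sub>M borel)"
    unfolding exponential_density_def split_beta by measurable
  show "distr M borel \<xi> = density lborel (\<lambda>x. ennreal (min_u_exp_density a l x))"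
    by (rule min_u_exp_law[OF a l prob_space_axioms xi])
  show "has_cond_distr_on M \<tau> \<xi> {0<..} (\<lambda>x. density lborel (\<lambda>t. ennreal (exponential_density x t)))"
    using cond unfolding exponential_law_def .
qed (auto simp: min_u_exp_density_def prob_space_axioms)

lemma joint_law:
  "distr M (borel \<Otimes>\<^sub>M borel) (\<lambda>w. (\<tau> w, \<xi> w)) =
    density (lborel \<Otimes>\<^sub>M lborel) (\<lambda>(t, x). ennreal (biv_exp_min_u_exp_density a l t x))"
  unfolding joint_law_product
proof (rule density_cong)
  show "(\<lambda>(t, x). ennreal (min_u_exp_density a l x) * ennreal (exponential_density x t))
      \<in> borel_measurable (lborel \<Otimes>\<^sub>M lborel)"
    unfolding exponential_density_def split_beta by measurable
  \<comment> \<open>At t = 0 the exponential density has the value x while the bivariate density is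
    0; this line is null in the plane.\<close>
  have "AE z :: real \<times> real in lborel \<Otimes>\<^sub>M lborel. fst z \<noteq> 0"
  proof (rule AE_I[where N="{0::real} \<times> (UNIV :: real set)"])
    show "emeasure (lborel \<Otimes>\<^sub>M lborel) ({0::real} \<times> (UNIV :: real set)) = 0"
      by (subst lborel.emeasure_pair_measure_Times) auto
  qed auto
  then show "AE z in lborel \<Otimes>\<^sub>M lborel.
      (case z of (t, x) \<Rightarrow> ennreal (min_u_exp_density a l x) * ennreal (exponential_density x t))
      = (case z of (t, x) \<Rightarrow> ennreal (biv_exp_min_u_exp_density a l t x))"
  proof eventually_elim
    fix z :: "real \<times> real" assume "fst z \<noteq> 0"
    then obtain t x where z: "z = (t, x)" "t \<noteq> 0" by (cases z) auto
    have "min_u_exp_density a l x * exponential_density x t = biv_exp_min_u_exp_density a l t x"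
      using z by (auto simp: min_u_exp_density_def exponential_density_def biv_exp_min_u_exp_density_def
          field_simps exp_add[symmetric] exp_minus)
    then show "(case z of (t, x) \<Rightarrow> ennreal (min_u_exp_density a l x) * ennreal (exponential_density x t))
      = (case z of (t, x) \<Rightarrow> ennreal (biv_exp_min_u_exp_density a l t x))"
      using min_u_exp_density_nonneg[OF a l, of x] by (simp add: z(1) ennreal_mult'[symmetric])
  qed
qed (auto simp: split_beta)

text \<open>Tonelli with \<tau> integrated first, for questions conditioned on \<xi>, such as the
  moments of \<tau>.\<close>

lemma nn_integral_pair_eq_exponential:
  assumes [measurable]: "g \<in> borel_measurable (borel \<Otimes>\<^sub>M borel)"
  shows "(\<integral>\<^sup>+w. g (\<tau> w, \<xi> w) \<partial>M) =
    (\<integral>\<^sup>+x. ennreal (min_u_exp_density a l x) * (\<integral>\<^sup>+t. g (t, x) \<partial>exponential_law x) \<partial>lborel)"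
proof -
  have [measurable]: "(\<lambda>(t, x). ennreal (min_u_exp_density a l x) * ennreal (exponential_density x t))
      \<in> borel_measurable (borel \<Otimes>\<^sub>M borel)"
    unfolding exponential_density_def split_beta by measurable
  have "(\<integral>\<^sup>+w. g (\<tau> w, \<xi> w) \<partial>M) = (\<integral>\<^sup>+z. g z \<partial>distr M (borel \<Otimes>\<^sub>M borel) (\<lambda>w. (\<tau> w, \<xi> w)))"
    by (subst nn_integral_distr) auto
  also have "\<dots> = (\<integral>\<^sup>+z. (case z of (t, x) \<Rightarrow> ennreal (min_u_exp_density a l x) * ennreal (exponential_density x t)) * g z
      \<partial>(lborel \<Otimes>\<^sub>M lborel))"
    unfolding joint_law_product by (subst nn_integral_density) auto
  also have "\<dots> = (\<integral>\<^sup>+x. \<integral>\<^sup>+t. ennreal (min_u_exp_density a l x) * ennreal (exponential_density x t) * g (t, x) \<partial>lborel \<partial>lborel)"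
    by (subst lborel_pair.nn_integral_snd[symmetric]) auto
  also have "\<dots> = (\<integral>\<^sup>+x. ennreal (min_u_exp_density a l x) * (\<integral>\<^sup>+t. g (t, x) \<partial>exponential_law x) \<partial>lborel)"
    unfolding exponential_law_def
    by (intro nn_integral_cong) (simp add: nn_integral_density nn_integral_cmult mult.assoc)
  finally show ?thesis .
qed

text \<open>Tonelli in the opposite order, for the law of \<tau> and for conditioning on
  \<tau>.\<close>

lemma nn_integral_pair_eq_density:
  assumes [measurable]: "g \<in> borel_measurable (borel \<Otimes>\<^sub>M borel)"
  shows "(\<integral>\<^sup>+w. g (\<tau> w, \<xi> w) \<partial>M) =
    (\<integral>\<^sup>+t. \<integral>\<^sup>+x. ennreal (biv_exp_min_u_exp_density a l t x) * g (t, x) \<partial>lborel \<partial>lborel)"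
proof -
  have "(\<integral>\<^sup>+w. g (\<tau> w, \<xi> w) \<partial>M) = (\<integral>\<^sup>+z. g z \<partial>distr M (borel \<Otimes>\<^sub>M borel) (\<lambda>w. (\<tau> w, \<xi> w)))"
    by (subst nn_integral_distr) auto
  also have "\<dots> = (\<integral>\<^sup>+z. (case z of (t, x) \<Rightarrow> ennreal (biv_exp_min_u_exp_density a l t x)) * g z \<partial>(lborel \<Otimes>\<^sub>M lborel))"
    unfolding joint_law by (subst nn_integral_density) auto
  also have "\<dots> = (\<integral>\<^sup>+t. \<integral>\<^sup>+x. ennreal (biv_exp_min_u_exp_density a l t x) * g (t, x) \<partial>lborel \<partial>lborel)"
    by (subst lborel.nn_integral_fst[symmetric]) auto
  finally show ?thesis .
qed

lemma nn_integral_biv_density: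
  "(\<integral>\<^sup>+x. ennreal (biv_exp_min_u_exp_density a l t x) \<partial>lborel) = ennreal (exp_min_u_exp_density a l t)"
proof (cases "0 < t")
  case True
  show ?thesis
    by (intro nn_integral_eq_has_bochner_integral has_bochner_integral_biv_density
        biv_exp_min_u_exp_density_nonneg a l True)
qed (simp add: biv_exp_min_u_exp_density_def exp_min_u_exp_density_def)

lemma exp_min_u_exp_density_nonneg: "0 \<le> exp_min_u_exp_density a l t"
  using exp_min_u_exp_density_pos[OF a l, of t] by (cases "0 < t") (auto simp: exp_min_u_exp_density_def)

lemma tau_law: "distr M borel \<tau> = density lborel (exp_min_u_exp_density a l)"
proof (rule measure_eqI)
  fix A assume "A \<in> sets (distr M borel \<tau>)"
  then have [measurable]: "A \<in> sets borel" by simp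
  have "emeasure (distr M borel \<tau>) A = (\<integral>\<^sup>+w. indicator A (fst (\<tau> w, \<xi> w)) \<partial>M)"
    by (subst nn_integral_indicator[symmetric]) (auto simp: nn_integral_distr simp del: nn_integral_indicator)
  also have "\<dots> = (\<integral>\<^sup>+t. \<integral>\<^sup>+x. ennreal (biv_exp_min_u_exp_density a l t x) * indicator A (fst (t, x)) \<partial>lborel \<partial>lborel)"
    by (rule nn_integral_pair_eq_density) measurable
  also have "\<dots> = (\<integral>\<^sup>+t. ennreal (exp_min_u_exp_density a l t) * indicator A t \<partial>lborel)"
    by (simp add: nn_integral_multc nn_integral_biv_density)
  also have "\<dots> = emeasure (density lborel (exp_min_u_exp_density a l)) A"
    by (subst emeasure_density) auto
  finally show "emeasure (distr M borel \<tau>) A = emeasure (density lborel (exp_min_u_exp_density a l)) A" .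
qed simp

lemma tau_exp_min_u_exp_distributed: "exp_min_u_exp_distributed M a l \<tau>"
  unfolding exp_min_u_exp_distributed_def tau_law
  by (intro conjI tau allI cdf_density_lborel has_bochner_integral_exp_min_u_exp_density_atMost
      exp_min_u_exp_density_nonneg a l) measurable

lemma biv_distributed: "biv_exp_min_u_exp_distributed M a l (\<lambda>w. (\<tau> w, \<xi> w))"
proof -
  \<comment> \<open>The target measure enters \<open>distr\<close> only through its measurable sets,
    which agree for \<open>lborel\<close> and \<open>borel\<close>.\<close>
  have "distr M (lborel \<Otimes>\<^sub>M lborel) (\<lambda>w. (\<tau> w, \<xi> w)) = distr M (borel \<Otimes>\<^sub>M borel) (\<lambda>w. (\<tau> w, \<xi> w))"
    by (intro distr_cong sets_pair_measure_cong) auto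
  then show ?thesis
    by (simp add: biv_exp_min_u_exp_distributed_def distributed_def joint_law split_beta)
qed

lemma AE_xi: "AE w in M. 0 < \<xi> w \<and> \<xi> w < a"
proof -
  have "AE x in distr M borel \<xi>. 0 < x \<and> x < a"
    unfolding min_u_exp_law[OF a l prob_space_axioms xi]
    by (subst AE_density) (auto simp: min_u_exp_density_def)
  then show ?thesis by (subst (asm) AE_distr_iff) auto
qed

lemma AE_tau: "AE w in M. 0 < \<tau> w"
proof -
  have "AE t in distr M borel \<tau>. 0 < t"
    unfolding tau_law by (subst AE_density) (auto simp: exp_min_u_exp_density_def)
  then show ?thesis by (subst (asm) AE_distr_iff) auto
qed

section \<open>Moments of \<tau>\<close>

lemma nn_integral_tau:
  assumes [measurable]: "g \<in> borel_measurable borel"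
  shows "(\<integral>\<^sup>+w. g (\<tau> w) \<partial>M) = (\<integral>\<^sup>+t. ennreal (exp_min_u_exp_density a l t) * g t \<partial>lborel)"
proof -
  have "(\<integral>\<^sup>+w. g (\<tau> w) \<partial>M) = (\<integral>\<^sup>+t. g t \<partial>distr M borel \<tau>)"
    by (subst nn_integral_distr) auto
  then show ?thesis
    unfolding tau_law by (subst (asm) nn_integral_density) auto
qed

lemma has_bochner_integral_tau_powr:
  assumes p: "- 1 < p" "p < 1"
  shows "has_bochner_integral M (\<lambda>w. \<tau> w powr p)
    (1 / a * Gamma (p + 1) * l powr (p - 1) *
      ((l * a + 1) * lower_inc_gamma (1 - p) (a * l) - lower_inc_gamma (2 - p) (a * l)))"
    (is "has_bochner_integral M _ ?V")
proof -
  have int: "has_bochner_integral lborel (\<lambda>x. Gamma (p + 1) * (min_u_exp_density a l x * x powr (- p))) ?V"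
    using has_bochner_integral_mult_right[OF has_bochner_integral_min_u_exp_powr[OF a l p(2)], of "Gamma (p + 1)"]
    by (simp add: mult_ac)
  have G: "0 \<le> Gamma (p + 1)" using p by (intro less_imp_le Gamma_real_pos) auto
  have nn: "0 \<le> Gamma (p + 1) * (min_u_exp_density a l x * x powr (- p))" for x
    using G min_u_exp_density_nonneg[OF a l, of x] by simp
  have "(\<integral>\<^sup>+w. ennreal (\<tau> w powr p) \<partial>M) = (\<integral>\<^sup>+w. ennreal (fst (\<tau> w, \<xi> w) powr p) \<partial>M)"
    by simp
  also have "\<dots> = (\<integral>\<^sup>+x. ennreal (min_u_exp_density a l x) * (\<integral>\<^sup>+t. ennreal (fst (t, x) powr p) \<partial>exponential_law x) \<partial>lborel)"
    by (rule nn_integral_pair_eq_exponential) measurable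
  also have "\<dots> = (\<integral>\<^sup>+x. ennreal (Gamma (p + 1) * (min_u_exp_density a l x * x powr (- p))) \<partial>lborel)"
  proof (intro nn_integral_cong)
    fix x
    \<comment> \<open>The moment formula for the kernel needs x > 0; for x \<le> 0 the density of
      \<xi> makes both sides 0.\<close>
    show "ennreal (min_u_exp_density a l x) * (\<integral>\<^sup>+t. ennreal (fst (t, x) powr p) \<partial>exponential_law x)
       = ennreal (Gamma (p + 1) * (min_u_exp_density a l x * x powr (- p)))"
      using nn_integral_powr_exponential_law[of x p] p min_u_exp_density_nonneg[OF a l, of x]
      by (cases "0 < x") (auto simp: ennreal_mult'[symmetric] mult_ac min_u_exp_density_def)
  qed
  also have "\<dots> = ennreal ?V"
    by (rule nn_integral_eq_has_bochner_integral[OF int nn])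
  finally have "(\<integral>\<^sup>+w. ennreal (\<tau> w powr p) \<partial>M) = ennreal ?V" .
  moreover have "0 \<le> ?V"
    unfolding has_bochner_integral_integral_eq[OF int, symmetric]
    by (rule Bochner_Integration.integral_nonneg) (rule nn)
  ultimately show ?thesis
    by (intro has_bochner_integral_nn_integral) auto
qed

text \<open>Two sources of divergence: for p \<le> -1 the inner moment is infinite at every x > 0;
  for p \<ge> 1 it is a finite multiple of x^(-p), which is not integrable at 0 against a density
  bounded below near 0.\<close>

lemma nn_integral_tau_powr_divergent:
  assumes p: "\<not> (- 1 < p \<and> p < 1)"
  shows "(\<integral>\<^sup>+w. ennreal (\<tau> w powr p) \<partial>M) = \<infinity>"
proof -
  \<comment> \<open>A lower bound for the density on (0, a): the exponential is smallest at a, and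
    the linear factor is at least 1.\<close>
  define C where "C = exp (- l * a) / a"
  have C: "0 < C" using a by (simp add: C_def)
  have f_ge: "C \<le> min_u_exp_density a l x" if "0 < x" "x < a" for x
  proof -
    have "exp (- l * a) / a * 1 \<le> exp (- l * x) / a * (1 + l * a - l * x)"
      using that a l by (intro mult_mono divide_right_mono) auto
    then show ?thesis using that by (simp add: C_def min_u_exp_density_def)
  qed
  have "(\<integral>\<^sup>+w. ennreal (\<tau> w powr p) \<partial>M) = (\<integral>\<^sup>+w. ennreal (fst (\<tau> w, \<xi> w) powr p) \<partial>M)"
    by simp
  also have "\<dots> = (\<integral>\<^sup>+x. ennreal (min_u_exp_density a l x) * (\<integral>\<^sup>+t. ennreal (fst (t, x) powr p) \<partial>exponential_law x) \<partial>lborel)"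
    by (rule nn_integral_pair_eq_exponential) measurable
  finally have eq: "(\<integral>\<^sup>+w. ennreal (\<tau> w powr p) \<partial>M)
      = (\<integral>\<^sup>+x. ennreal (min_u_exp_density a l x) * (\<integral>\<^sup>+t. ennreal (t powr p) \<partial>exponential_law x) \<partial>lborel)"
    by simp
  show ?thesis
  proof (cases "p \<le> - 1")
    case True
    have "\<infinity> = (\<integral>\<^sup>+x. \<infinity> * indicator {0<..<a} x \<partial>lborel)"
      using a by (subst nn_integral_cmult_indicator) (auto simp: ennreal_top_mult)
    also have "\<dots> \<le> (\<integral>\<^sup>+w. ennreal (\<tau> w powr p) \<partial>M)"
      unfolding eq
    proof (intro nn_integral_mono)
      fix x
      show "\<infinity> * indicator {0<..<a} x \<le> ennreal (min_u_exp_density a l x) * (\<integral>\<^sup>+t. ennreal (t powr p) \<partial>exponential_law x)"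
        using nn_integral_powr_exponential_law_divergent[of x p] True f_ge[of x] C
        by (auto simp: ennreal_mult_top split: split_indicator)
    qed
    finally show ?thesis by (simp add: top_unique)
  next
    case False
    with p have p1: "1 \<le> p" by auto
    define G where "G = Gamma (p + 1)"
    have G: "0 < G" unfolding G_def using p1 by (intro Gamma_real_pos) auto
    have "\<infinity> = ennreal (C * G) * (\<integral>\<^sup>+x. ennreal (x powr (- p)) * indicator {0<..<a} x \<partial>lborel)"
      using nn_integral_powr_divergent[OF a, of "- p"] p1 C G by (simp add: ennreal_mult_top)
    also have "\<dots> = (\<integral>\<^sup>+x. ennreal (C * G) * (ennreal (x powr (- p)) * indicator {0<..<a} x) \<partial>lborel)"
      by (subst nn_integral_cmult) auto
    also have "\<dots> \<le> (\<integral>\<^sup>+w. ennreal (\<tau> w powr p) \<partial>M)"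
      unfolding eq
    proof (intro nn_integral_mono)
      fix x
      show "ennreal (C * G) * (ennreal (x powr (- p)) * indicator {0<..<a} x)
        \<le> ennreal (min_u_exp_density a l x) * (\<integral>\<^sup>+t. ennreal (t powr p) \<partial>exponential_law x)"
        using nn_integral_powr_exponential_law[of x p, folded G_def] p1 f_ge[of x] C G
        by (auto simp: ennreal_mult'[symmetric] mult.assoc intro!: ennreal_leI mult_right_mono split: split_indicator)
    qed
    finally show ?thesis by (simp add: top_unique)
  qed
qed

section \<open>Conditional law of \<xi> given \<tau>\<close>

lemma cond_density_eq:
  "cond_density (biv_exp_min_u_exp_density a l) t x =
    biv_exp_min_u_exp_density a l t x / exp_min_u_exp_density a l t"
proof (cases "0 < t")
  case True
  then show ?thesis
    using has_bochner_integral_biv_density[OF a l, of t]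
    by (simp add: cond_density_def has_bochner_integral_iff)
\<comment> \<open>For t \<le> 0 the joint density is 0 and so are both quotients. Hence the equation
  holds for all t and can be unfolded in measurability goals without side conditions.\<close>
qed (simp add: cond_density_def biv_exp_min_u_exp_density_def)

lemma cond_density_explicit:
  assumes t: "0 < t" and x: "x \<in> {0<..<a}"
  shows "cond_density (biv_exp_min_u_exp_density a l) t x =
          x * (l + t) ^ 3 * exp (- (l + t) * x) * (1 + l * a - l * x) /
          (a * l * (l + t) + (t - l) * (1 - exp (- a * (l + t)))
            - a * t * (l + t) * exp (- a * (l + t)))"
  using t x a l by (simp add: cond_density_eq biv_exp_min_u_exp_density_def exp_min_u_exp_density_def mult_ac)

lemma cond_density_law_measurable:
  "cond_density_law (biv_exp_min_u_exp_density a l) \<in> restrict_space borel {0<..} \<rightarrow>\<^sub>M prob_algebra borel"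
  unfolding cond_density_law_def[abs_def]
proof (rule measurable_density_kernel)
  show "(\<lambda>(t, x). ennreal (cond_density (biv_exp_min_u_exp_density a l) t x)) \<in> borel_measurable (borel \<Otimes>\<^sub>M borel)"
    unfolding cond_density_eq using borel_measurable_biv_exp_min_u_exp_density(1)[of a l]
    unfolding split_beta by measurable
  fix t :: real assume "t \<in> {0<..}"
  then have t: "0 < t" by simp
  have "(\<integral>\<^sup>+x. ennreal (cond_density (biv_exp_min_u_exp_density a l) t x) \<partial>lborel)
      = (\<integral>\<^sup>+x. ennreal (biv_exp_min_u_exp_density a l t x) / ennreal (exp_min_u_exp_density a l t) \<partial>lborel)"
    using exp_min_u_exp_density_pos[OF a l t] biv_exp_min_u_exp_density_nonneg[OF a l]
    by (intro nn_integral_cong) (simp add: cond_density_eq divide_ennreal)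
  also have "\<dots> = 1"
    using exp_min_u_exp_density_pos[OF a l t]
    by (subst nn_integral_divide) (auto simp: nn_integral_biv_density divide_ennreal)
  finally show "prob_space (density lborel (\<lambda>x. ennreal (cond_density (biv_exp_min_u_exp_density a l) t x)))"
    by (intro prob_spaceI) (simp add: emeasure_density cond_density_eq)
qed

text \<open>The joint density factors as the marginal of \<tau> times the conditional density, since
  the marginal is positive for t > 0; Tonelli then gives the disintegration.\<close>

lemma xi_has_cond_distr:
  "has_cond_distr_on M \<xi> \<tau> {0<..} (cond_density_law (biv_exp_min_u_exp_density a l))"
  unfolding has_cond_distr_on_def
proof (intro conjI ballI impI)
  fix A B :: "real set" assume [measurable]: "A \<in> sets borel" "B \<in> sets borel" and A: "A \<subseteq> {0<..}"
  have "emeasure M {w \<in> space M. \<tau> w \<in> A \<and> \<xi> w \<in> B} = (\<integral>\<^sup>+w. indicator {w \<in> space M. \<tau> w \<in> A \<and> \<xi> w \<in> B} w \<partial>M)"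
    by (rule nn_integral_indicator[symmetric]) measurable
  also have "\<dots> = (\<integral>\<^sup>+w. indicator (A \<times> B) (\<tau> w, \<xi> w) \<partial>M)"
    by (intro nn_integral_cong) (auto split: split_indicator)
  also have "\<dots> = (\<integral>\<^sup>+t. \<integral>\<^sup>+x. ennreal (biv_exp_min_u_exp_density a l t x) * indicator (A \<times> B) (t, x) \<partial>lborel \<partial>lborel)"
    by (rule nn_integral_pair_eq_density) measurable
  also have "\<dots> = (\<integral>\<^sup>+t. ennreal (exp_min_u_exp_density a l t) *
      (emeasure (cond_density_law (biv_exp_min_u_exp_density a l) t) B * indicator A t) \<partial>lborel)"
  proof (intro nn_integral_cong)
    fix t :: real
    show "(\<integral>\<^sup>+x. ennreal (biv_exp_min_u_exp_density a l t x) * indicator (A \<times> B) (t, x) \<partial>lborel)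
      = ennreal (exp_min_u_exp_density a l t) *
        (emeasure (cond_density_law (biv_exp_min_u_exp_density a l) t) B * indicator A t)"
    proof (cases "t \<in> A")
      case True
      with A have t: "0 < t" by auto
      have "(\<integral>\<^sup>+x. ennreal (biv_exp_min_u_exp_density a l t x) * indicator (A \<times> B) (t, x) \<partial>lborel)
        = (\<integral>\<^sup>+x. ennreal (exp_min_u_exp_density a l t) *
            (ennreal (cond_density (biv_exp_min_u_exp_density a l) t x) * indicator B x) \<partial>lborel)"
        using True exp_min_u_exp_density_pos[OF a l t] biv_exp_min_u_exp_density_nonneg[OF a l]
        by (intro nn_integral_cong) (auto simp: cond_density_eq ennreal_mult[symmetric] split: split_indicator)
      also have "\<dots> = ennreal (exp_min_u_exp_density a l t) *
          emeasure (cond_density_law (biv_exp_min_u_exp_density a l) t) B"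
        unfolding cond_density_law_def
        by (subst nn_integral_cmult) (auto simp: emeasure_density cond_density_eq)
      finally show ?thesis using True by simp
    qed simp
  qed
  also have "\<dots> = (\<integral>\<^sup>+t\<in>A. emeasure (cond_density_law (biv_exp_min_u_exp_density a l) t) B \<partial>distr M borel \<tau>)"
  proof -
    \<comment> \<open>Passing to the density of \<tau> requires measurability in t, which is visible
      once the kernel is written as a parameter integral.\<close>
    have "emeasure (cond_density_law (biv_exp_min_u_exp_density a l) t) B
       = (\<integral>\<^sup>+x. ennreal (cond_density (biv_exp_min_u_exp_density a l) t x) * indicator B x \<partial>lborel)" for t
      unfolding cond_density_law_def by (subst emeasure_density) (auto simp: cond_density_eq)
    moreover have "(\<lambda>t. \<integral>\<^sup>+x. ennreal (cond_density (biv_exp_min_u_exp_density a l) t x) * indicator B x \<partial>lborel)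
        \<in> borel_measurable borel"
      unfolding cond_density_eq using borel_measurable_biv_exp_min_u_exp_density(1)[of a l]
      by measurable
    ultimately show ?thesis
      unfolding tau_law by (subst nn_integral_density) auto
  qed
  finally show "emeasure M {w \<in> space M. \<tau> w \<in> A \<and> \<xi> w \<in> B}
     = (\<integral>\<^sup>+t\<in>A. emeasure (cond_density_law (biv_exp_min_u_exp_density a l) t) B \<partial>distr M borel \<tau>)" .
qed (rule cond_density_law_measurable)

section \<open>Regressions\<close>

lemma times_biv_density_nonneg: "0 \<le> x * biv_exp_min_u_exp_density a l t x"
  using biv_exp_min_u_exp_density_nonneg[OF a l, of t x]
  by (cases "0 < x") (auto simp: biv_exp_min_u_exp_density_def[of _ _ _ x])

text \<open>The denominator of the regression is (l + t) times the numerator \<open>d\<close> of the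
  marginal density, so \<open>d\<close> cancels in the product and the explicit moment
  remains.\<close>

lemma has_bochner_integral_biv_density_moment:
  assumes t: "0 < t"
  shows "has_bochner_integral lborel (\<lambda>x. x * biv_exp_min_u_exp_density a l t x)
    (exp_min_u_exp_density a l t * exp_min_u_exp_regression a l t)"
proof -
  define s where "s = l + t"
  define n where "n = 2 * (t - 2 * l) + 2 * a * l * (t + l) - exp (- a * (l + t))
          * (a\<^sup>2 * t * (l + t)\<^sup>2 + 2 * a * (t\<^sup>2 - l\<^sup>2) + 2 * (t - 2 * l))"
  define d where "d = a * l * (l + t) + (t - l) * (1 - exp (- a * (l + t))) - a * t * (l + t) * exp (- a * (l + t))"
  have s: "0 < s" using t l by (simp add: s_def)
  have m: "exp_min_u_exp_density a l t = d / (a * s ^ 3)"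
    using t by (simp add: exp_min_u_exp_density_def d_def s_def)
  have d: "d \<noteq> 0"
    using exp_min_u_exp_density_pos[OF a l t] m by auto
  have "exp_min_u_exp_regression a l t = n / (s * d)"
    unfolding exp_min_u_exp_regression_def n_def d_def s_def
    by (rule arg_cong[where f="(/) _"]) (simp add: algebra_simps power2_eq_square)
  then have "exp_min_u_exp_density a l t * exp_min_u_exp_regression a l t = n / (a * s ^ 4)"
    using d s a by (simp add: m field_simps power3_eq_cube power4_eq_xxxx)
  then show ?thesis
    using has_bochner_integral_biv_density_moment_explicit[OF a l t] by (simp add: n_def s_def)
qed

lemma exp_min_u_exp_regression_nonneg:
  assumes t: "0 < t"
  shows "0 \<le> exp_min_u_exp_regression a l t"
proof -
  have "0 \<le> exp_min_u_exp_density a l t * exp_min_u_exp_regression a l t"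
    unfolding has_bochner_integral_integral_eq[OF has_bochner_integral_biv_density_moment[OF t], symmetric]
    by (rule Bochner_Integration.integral_nonneg) (rule times_biv_density_nonneg)
  then show ?thesis
    using exp_min_u_exp_density_pos[OF a l t] by (simp add: zero_le_mult_iff)
qed

lemma cond_density_law_mean:
  assumes t: "0 < t"
  shows "has_bochner_integral (cond_density_law (biv_exp_min_u_exp_density a l) t) (\<lambda>x. x)
    (exp_min_u_exp_regression a l t)"
  unfolding cond_density_law_def
proof (rule has_bochner_integral_density)
  have "has_bochner_integral lborel (\<lambda>x. x * biv_exp_min_u_exp_density a l t x / exp_min_u_exp_density a l t)
    (exp_min_u_exp_density a l t * exp_min_u_exp_regression a l t / exp_min_u_exp_density a l t)"
    by (intro has_bochner_integral_divide_zero has_bochner_integral_biv_density_moment t)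
  then show "has_bochner_integral lborel (\<lambda>x. cond_density (biv_exp_min_u_exp_density a l) t x *\<^sub>R x)
    (exp_min_u_exp_regression a l t)"
    using exp_min_u_exp_density_pos[OF a l t] by (simp add: cond_density_eq mult_ac)
qed (auto simp: cond_density_eq biv_exp_min_u_exp_density_nonneg[OF a l] exp_min_u_exp_density_nonneg)

text \<open>The nonnegative version of conditional expectation is essential: the moment of order p =
  1 is infinite, so \<tau> is not integrable.\<close>

lemma nn_cond_exp_tau:
  "AE w in M. nn_cond_exp M (generated_by M \<xi>) (\<lambda>w. ennreal (\<tau> w)) w = ennreal (1 / \<xi> w)"
proof -
  interpret sigma_finite_subalgebra M "generated_by M \<xi>"
    by (rule sigma_finite_subalgebra_generated_by) (auto simp: prob_space_axioms)
  have "AE w in M. ennreal (1 / \<xi> w) = nn_cond_exp M (generated_by M \<xi>) (\<lambda>w. ennreal (\<tau> w)) w"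
  proof (rule nn_cond_exp_charact)
    fix A assume "A \<in> sets (generated_by M \<xi>)"
    then obtain S where [measurable]: "S \<in> sets borel" and A: "A = \<xi> -` S \<inter> space M"
      by (auto simp: sets_vimage_algebra2)
    \<comment> \<open>Stated for general \<open>g\<close>, to be applied to both candidates t and 1
      / x; the event depends on \<xi> alone, so its indicator is constant in the inner
      integral.\<close>
    have eq: "(\<integral>\<^sup>+w\<in>A. g (\<tau> w, \<xi> w) \<partial>M) =
       (\<integral>\<^sup>+x. ennreal (min_u_exp_density a l x) * (\<integral>\<^sup>+t. g (t, x) * indicator S x \<partial>exponential_law x) \<partial>lborel)"
      if [measurable]: "g \<in> borel_measurable (borel \<Otimes>\<^sub>M borel)" for g
    proof -
      have "(\<integral>\<^sup>+w\<in>A. g (\<tau> w, \<xi> w) \<partial>M) = (\<integral>\<^sup>+w. (\<lambda>z. g z * indicator S (snd z)) (\<tau> w, \<xi> w) \<partial>M)"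
        by (intro nn_integral_cong) (auto simp: A split: split_indicator)
      also have "\<dots> = (\<integral>\<^sup>+x. ennreal (min_u_exp_density a l x) * (\<integral>\<^sup>+t. (\<lambda>z. g z * indicator S (snd z)) (t, x) \<partial>exponential_law x) \<partial>lborel)"
        by (rule nn_integral_pair_eq_exponential) measurable
      finally show ?thesis by simp
    qed
    have "(\<integral>\<^sup>+w\<in>A. ennreal (\<tau> w) \<partial>M) =
       (\<integral>\<^sup>+x. ennreal (min_u_exp_density a l x) * (\<integral>\<^sup>+t. ennreal t * indicator S x \<partial>exponential_law x) \<partial>lborel)"
      using eq[of "\<lambda>z. ennreal (fst z)"] by simp
    also have "\<dots> = (\<integral>\<^sup>+x. ennreal (min_u_exp_density a l x) * (\<integral>\<^sup>+t. ennreal (1 / x) * indicator S x \<partial>exponential_law x) \<partial>lborel)"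
    proof (intro nn_integral_cong)
      fix x
      show "ennreal (min_u_exp_density a l x) * (\<integral>\<^sup>+t. ennreal t * indicator S x \<partial>exponential_law x)
        = ennreal (min_u_exp_density a l x) * (\<integral>\<^sup>+t. ennreal (1 / x) * indicator S x \<partial>exponential_law x)"
      \<comment> \<open>For x > 0 the kernel has mean 1 / x and total mass 1, so integrating t or
        the constant 1 / x gives the same; otherwise the density of \<xi> vanishes.\<close>
      proof (cases "0 < x")
        case True
        have "emeasure (exponential_law x) (space (exponential_law x)) = 1"
          using prob_space.emeasure_space_1[OF prob_space_exponential_density[OF True]]
          by (simp add: exponential_law_def)
        moreover have "(\<integral>\<^sup>+t. ennreal t \<partial>exponential_law x) = ennreal (1 / x)"
          by (rule nn_integral_exponential_law_id[OF True])
        ultimately show ?thesis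
          by (auto split: split_indicator)
      qed (simp add: min_u_exp_density_def)
    qed
    also have "\<dots> = (\<integral>\<^sup>+w\<in>A. ennreal (1 / \<xi> w) \<partial>M)"
      using eq[of "\<lambda>z. ennreal (1 / snd z)"] by simp
    finally show "(\<integral>\<^sup>+w\<in>A. ennreal (\<tau> w) \<partial>M) = (\<integral>\<^sup>+w\<in>A. ennreal (1 / \<xi> w) \<partial>M)" .
  next
    have [measurable]: "\<xi> \<in> borel_measurable (generated_by M \<xi>)"
      by (rule measurable_vimage_algebra1) auto
    show "(\<lambda>w. ennreal (1 / \<xi> w)) \<in> borel_measurable (generated_by M \<xi>)"
      by measurable
  qed auto
  then show ?thesis by eventually_elim simp
qed

text \<open>Here the real version applies, because \<xi> is almost surely in the bounded interval
  (0, a). The defining identity is proved with nonnegative integrals and then transferred, both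
  integrands being almost surely nonnegative.\<close>

lemma real_cond_exp_xi:
  "AE w in M. real_cond_exp M (generated_by M \<tau>) \<xi> w = exp_min_u_exp_regression a l (\<tau> w)"
proof -
  interpret sigma_finite_subalgebra M "generated_by M \<tau>"
    by (rule sigma_finite_subalgebra_generated_by) (auto simp: prob_space_axioms)
  let ?r = "exp_min_u_exp_regression a l"
  have eq: "(\<integral>\<^sup>+w. ennreal (indicator S (\<tau> w) * \<xi> w) \<partial>M) = (\<integral>\<^sup>+w. ennreal (indicator S (\<tau> w) * ?r (\<tau> w)) \<partial>M)"
    if [measurable]: "S \<in> sets borel" for S
  proof -
    have "(\<integral>\<^sup>+w. ennreal (indicator S (\<tau> w) * \<xi> w) \<partial>M)
      = (\<integral>\<^sup>+w. (\<lambda>z. ennreal (indicator S (fst z) * snd z)) (\<tau> w, \<xi> w) \<partial>M)" by simp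
    also have "\<dots> = (\<integral>\<^sup>+t. \<integral>\<^sup>+x. ennreal (biv_exp_min_u_exp_density a l t x) *
        (\<lambda>z. ennreal (indicator S (fst z) * snd z)) (t, x) \<partial>lborel \<partial>lborel)"
      by (rule nn_integral_pair_eq_density) measurable
    also have "\<dots> = (\<integral>\<^sup>+t. ennreal (exp_min_u_exp_density a l t) * ennreal (indicator S t * ?r t) \<partial>lborel)"
    proof (intro nn_integral_cong)
      fix t
      show "(\<integral>\<^sup>+x. ennreal (biv_exp_min_u_exp_density a l t x) * (\<lambda>z. ennreal (indicator S (fst z) * snd z)) (t, x) \<partial>lborel)
        = ennreal (exp_min_u_exp_density a l t) * ennreal (indicator S t * ?r t)"
      proof (cases "0 < t \<and> t \<in> S")
        case True
        have "(\<integral>\<^sup>+x. ennreal (biv_exp_min_u_exp_density a l t x) * ennreal x \<partial>lborel)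
          = (\<integral>\<^sup>+x. ennreal (x * biv_exp_min_u_exp_density a l t x) \<partial>lborel)"
          using biv_exp_min_u_exp_density_nonneg[OF a l, of t]
          by (intro nn_integral_cong) (simp add: ennreal_mult''[symmetric] mult.commute)
        also have "\<dots> = ennreal (exp_min_u_exp_density a l t * ?r t)"
          using True by (intro nn_integral_eq_has_bochner_integral has_bochner_integral_biv_density_moment
                times_biv_density_nonneg) auto
        finally show ?thesis
          using True exp_min_u_exp_density_nonneg[of t] by (simp add: ennreal_mult')
      next
        case False
        then show ?thesis
          by (auto simp: biv_exp_min_u_exp_density_def exp_min_u_exp_density_def)
      qed
    qed
    also have "\<dots> = (\<integral>\<^sup>+w. ennreal (indicator S (\<tau> w) * ?r (\<tau> w)) \<partial>M)"
      by (rule nn_integral_tau[symmetric]) measurable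
    finally show ?thesis .
  qed
  have r_nn: "AE w in M. 0 \<le> ?r (\<tau> w)"
    using AE_tau by eventually_elim (rule exp_min_u_exp_regression_nonneg)
  have xi_nn: "AE w in M. 0 \<le> \<xi> w"
    using AE_xi by eventually_elim auto
  have int_xi: "integrable M \<xi>"
  proof (rule integrable_const_bound[where B=a])
    show "AE w in M. norm (\<xi> w) \<le> a"
      using AE_xi by eventually_elim simp
  qed simp
  have "(\<integral>\<^sup>+w. ennreal (\<xi> w) \<partial>M) \<noteq> \<infinity>"
    using int_xi xi_nn by (simp add: nn_integral_eq_integral)
  \<comment> \<open>Taking \<open>S\<close> to be \<open>UNIV\<close> shows that the regression has
    the same finite integral as \<xi>.\<close>
  then have int_r: "integrable M (\<lambda>w. ?r (\<tau> w))"
    using eq[of UNIV] r_nn by (intro integrableI_nonneg) (auto simp: less_top)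
  show ?thesis
  proof (rule real_cond_exp_charact)
    fix A assume "A \<in> sets (generated_by M \<tau>)"
    then obtain S where S[measurable]: "S \<in> sets borel" and A: "A = \<tau> -` S \<inter> space M"
      by (auto simp: sets_vimage_algebra2)
    have "(\<integral>w\<in>A. \<xi> w \<partial>M) = (\<integral>w. indicator S (\<tau> w) * \<xi> w \<partial>M)"
      unfolding set_lebesgue_integral_def
      by (intro Bochner_Integration.integral_cong) (auto simp: A split: split_indicator)
    also have "\<dots> = (\<integral>w. indicator S (\<tau> w) * ?r (\<tau> w) \<partial>M)"
      using xi_nn r_nn by (subst (1 2) integral_eq_nn_integral) (auto simp: eq[OF S])
    also have "\<dots> = (\<integral>w\<in>A. ?r (\<tau> w) \<partial>M)"
      unfolding set_lebesgue_integral_def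
      by (intro Bochner_Integration.integral_cong) (auto simp: A split: split_indicator)
    finally show "(\<integral>w\<in>A. \<xi> w \<partial>M) = (\<integral>w\<in>A. ?r (\<tau> w) \<partial>M)" .
  next
    have [measurable]: "\<tau> \<in> borel_measurable (generated_by M \<tau>)"
      by (rule measurable_vimage_algebra1) auto
    show "(\<lambda>w. ?r (\<tau> w)) \<in> borel_measurable (generated_by M \<tau>)"
      by measurable
  qed (use int_xi int_r in auto)
qed

end

section \<open>Collecting the claims\<close>

theorem theorem2:
  fixes M :: "'a measure" and a l :: real and \<xi> \<tau> :: "'a \<Rightarrow> real"
  assumes "prob_space M"
    and "a > 0" and "l > 0"
    and "min_u_exp_distributed M a l \<xi>"
    and "\<tau> \<in> borel_measurable M"
    and "has_cond_distr_on M \<tau> \<xi> {0<..} exponential_law"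
  shows
    \<comment> \<open>(a)\<close>
    "exp_min_u_exp_distributed M a l \<tau>
    \<and>
    \<comment> \<open>(b)\<close>
    (\<forall>(N :: 'b measure) \<xi>' \<eta>.
       prob_space N \<and> min_u_exp_distributed N a l \<xi>' \<and>
       distributed N lborel \<eta> (\<lambda>y. ennreal (exponential_density 1 y)) \<and>
       prob_space.indep_var N borel \<xi>' borel \<eta> \<longrightarrow>
       distr M borel \<tau> = distr N borel (\<lambda>w. \<eta> w / \<xi>' w))
    \<and>
    \<comment> \<open>(c)\<close>
    (\<forall>p. (- 1 < p \<and> p < 1 \<longrightarrow>
          has_bochner_integral M (\<lambda>w. \<tau> w powr p)
            (1 / a * Gamma (p + 1) * l powr (p - 1) *
              ((l * a + 1) * lower_inc_gamma (1 - p) (a * l)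
                - lower_inc_gamma (2 - p) (a * l)))) \<and>
         (\<not> (- 1 < p \<and> p < 1) \<longrightarrow>
          (\<integral>\<^sup>+w. ennreal (\<tau> w powr p) \<partial>M) = \<infinity>))
    \<and>
    \<comment> \<open>(d)\<close>
    biv_exp_min_u_exp_distributed M a l (\<lambda>w. (\<tau> w, \<xi> w))
    \<and>
    (\<forall>(N :: 'b measure) \<xi>' \<eta>.
       prob_space N \<and> min_u_exp_distributed N a l \<xi>' \<and>
       distributed N lborel \<eta> (\<lambda>y. ennreal (exponential_density 1 y)) \<and>
       prob_space.indep_var N borel \<xi>' borel \<eta> \<longrightarrow>
       distr M (borel \<Otimes>\<^sub>M borel) (\<lambda>w. (\<tau> w, \<xi> w)) =
       distr N (borel \<Otimes>\<^sub>M borel) (\<lambda>w. (\<eta> w / \<xi>' w, \<xi>' w)))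
    \<and>
    \<comment> \<open>(e)\<close>
    has_cond_distr_on M \<xi> \<tau> {0<..} (cond_density_law (biv_exp_min_u_exp_density a l))
    \<and>
    (\<forall>t>0.
       (\<forall>x. x \<notin> {0<..<a} \<longrightarrow> cond_density (biv_exp_min_u_exp_density a l) t x = 0) \<and>
       (\<forall>x\<in>{0<..<a}. cond_density (biv_exp_min_u_exp_density a l) t x =
          x * (l + t) ^ 3 * exp (- (l + t) * x) * (1 + l * a - l * x) /
          (a * l * (l + t) + (t - l) * (1 - exp (- a * (l + t)))
            - a * t * (l + t) * exp (- a * (l + t)))))
    \<and>
    \<comment> \<open>(f)\<close>
    (\<forall>x>0. has_bochner_integral (exponential_law x) (\<lambda>t. t) (1 / x))
    \<and>
    (AE w in M. nn_cond_exp M (generated_by M \<xi>) (\<lambda>w. ennreal (\<tau> w)) w = ennreal (1 / \<xi> w))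
    \<and>
    \<comment> \<open>(g)\<close>
    (\<forall>t>0. has_bochner_integral (cond_density_law (biv_exp_min_u_exp_density a l) t) (\<lambda>x. x)
       (exp_min_u_exp_regression a l t))
    \<and>
    (AE w in M. real_cond_exp M (generated_by M \<tau>) \<xi> w = exp_min_u_exp_regression a l (\<tau> w))"
proof -
  interpret exp_min_u_exp_pair M a l \<xi> \<tau>
    using assms by (simp add: exp_min_u_exp_pair_def exp_min_u_exp_pair_axioms_def)
  \<comment> \<open>Once the quotient pair is an instance of the locale, equality in distribution
    follows by comparing both laws with the same explicit density.\<close>
  have quotient: "exp_min_u_exp_pair N a l \<xi>' (\<lambda>w. \<eta> w / \<xi>' w)"
    if "prob_space N \<and> min_u_exp_distributed N a l \<xi>' \<and>
       distributed N lborel \<eta> (\<lambda>y. ennreal (exponential_density 1 y)) \<and>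
       prob_space.indep_var N borel \<xi>' borel \<eta>"
    for N :: "'b measure" and \<xi>' \<eta>
  proof -
    have [measurable]: "\<xi>' \<in> borel_measurable N" "\<eta> \<in> borel_measurable N"
      using that by (auto simp: min_u_exp_distributed_def distributed_def)
    have "(\<lambda>w. \<eta> w / \<xi>' w) \<in> borel_measurable N" by measurable
    then show ?thesis
      using that a l has_cond_distr_on_exponential_quotient[of N \<eta> \<xi>']
      by (simp add: exp_min_u_exp_pair_def exp_min_u_exp_pair_axioms_def)
  qed
  show ?thesis
  proof (intro conjI allI impI ballI)
    show "exp_min_u_exp_distributed M a l \<tau>"
      by (rule tau_exp_min_u_exp_distributed)
  next
    fix N :: "'b measure" and \<xi>' \<eta>
    assume "prob_space N \<and> min_u_exp_distributed N a l \<xi>' \<and>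
       distributed N lborel \<eta> (\<lambda>y. ennreal (exponential_density 1 y)) \<and>
       prob_space.indep_var N borel \<xi>' borel \<eta>"
    then interpret N: exp_min_u_exp_pair N a l \<xi>' "\<lambda>w. \<eta> w / \<xi>' w"
      by (rule quotient)
    show "distr M borel \<tau> = distr N borel (\<lambda>w. \<eta> w / \<xi>' w)"
      by (simp only: tau_law N.tau_law)
    show "distr M (borel \<Otimes>\<^sub>M borel) (\<lambda>w. (\<tau> w, \<xi> w)) =
       distr N (borel \<Otimes>\<^sub>M borel) (\<lambda>w. (\<eta> w / \<xi>' w, \<xi>' w))"
      by (simp only: joint_law N.joint_law)
  next
    fix p :: real
    assume "- 1 < p \<and> p < 1"
    then show "has_bochner_integral M (\<lambda>w. \<tau> w powr p)
            (1 / a * Gamma (p + 1) * l powr (p - 1) *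
              ((l * a + 1) * lower_inc_gamma (1 - p) (a * l)
                - lower_inc_gamma (2 - p) (a * l)))"
      by (intro has_bochner_integral_tau_powr) auto
  next
    fix t x :: real
    assume "0 < t" "x \<notin> {0<..<a}"
    then show "cond_density (biv_exp_min_u_exp_density a l) t x = 0"
      by (auto simp: cond_density_def biv_exp_min_u_exp_density_def)
  qed (intro nn_integral_tau_powr_divergent biv_distributed xi_has_cond_distr
      cond_density_explicit exponential_law_mean nn_cond_exp_tau cond_density_law_mean
      real_cond_exp_xi; assumption)+
qed

end
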